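(* Let $\theta>0$ and, for each integer $k\ge 1$, let $\gamma_k\in(0,\infty)$ be the unique root in $x\in(0,\infty)$ of $$\theta\, D_aM(k,\theta+k,x)-M(k,\theta+k,x)=0 .$$ Then the roots $\gamma_k$ are increasing in $k$. Consequently, for every $\lambda\in(0,\infty)$, in the last-success problem on $[0,1]$ with trials arriving at the epochs of a homogeneous Poisson process of intensity $\lambda$ and with success probabilities $p_k=\theta/(\theta+k-1)$, the stopping rule $\tau^*$ which stops at the first success state $(t,k)^\circ$ satisfying $$(1-t)\lambda\le\gamma_k$$ is optimal, i.e. it maximises the probability of stopping at the last success among all stopping strategies.
   Context: Kummer's function is $M(a,c,x)=\sum_{j\ge 0}\frac{(a)_j}{(c)_j}\frac{x^j}{j!}$, where $(a)_j=a(a+1)\cdots(a+j-1)$ and $(a)_0=1$. $D_aM(k,\theta+k,x)$ denotes the partial derivative of $M(a,c,x)$ in its first parameter $a$, evaluated at $a=k$, $c=\theta+k$. Last-success problem: $T_1<T_2<\cdots$ are the arrival epochs in $[0,1]$ of a homogeneous Poisson process of known intensity $\lambda$; $N_t$ is the number of arrivals in $[0,t]$ and $N=N_1$ is the total number of arrivals (Poisson with mean $\lambda$). The $k$th arrival carries a Bernoulli mark (trial) $X_k$ with $P(X_k=1)=p_k=\theta/(\theta+k-1)$; the marks are mutually independent and independent of the arrival process. The $k$th trial is a success if $X_k=1$. The process is in success state $(t,k)^\circ$ if the $k$th arrival occurs at time $T_k=t$ and $X_k=1$. Let $\mathcal F_t$ be the $\sigma$-algebra generated by all arrival epochs and marks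 observed in $[0,t]$. A stopping strategy is a random variable $\tau$ with values in $\{T_1,\ldots,T_N,1\}$ adapted to $(\mathcal F_t)_{t\in[0,1]}$, where $\tau=1$ means not stopping at all. The strategy wins if it stops at some $T_k=t$ with $X_k=1$ and there are no successes in $(t,1]$. The equation defining $\gamma_k$ expresses equality of the conditional probabilities, given $N_t=k$ and with $x=(1-t)\lambda$, of exactly one success after time $t$, namely $\theta e^{-x}D_aM(k,\theta+k,x)$, and of no success after time $t$, namely $e^{-x}M(k,\theta+k,x)$. *)

theory Defs
  imports "HOL-Probability.Probability"
begin

definition kummer :: "real \<Rightarrow> real \<Rightarrow> real \<Rightarrow> real" where
  "kummer a c x = (\<Sum>j. pochhammer a j / pochhammer c j * (x ^ j / fact j))"

definition kummer_da :: "real \<Rightarrow> real \<Rightarrow> real \<Rightarrow> real" where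
  "kummer_da a c x = deriv (\<lambda>b. kummer b c x) a"

definition is_kummer_root :: "real \<Rightarrow> nat \<Rightarrow> real \<Rightarrow> bool" where
  "is_kummer_root \<theta> k x \<longleftrightarrow>
     0 < x \<and> \<theta> * kummer_da (real k) (\<theta> + real k) x - kummer (real k) (\<theta> + real k) x = 0"

definition kummer_root :: "real \<Rightarrow> nat \<Rightarrow> real" where
  "kummer_root \<theta> k = (THE x. is_kummer_root \<theta> k x)"

text \<open>Arrivals and marks are numbered from 1; the index 0 of a sequence \<open>T\<close> of arrival epochs or of
  a sequence \<open>X\<close> of marks is never used. The mark of an arrival is a truth value, with \<open>True\<close>
  for success. The process lives on the time interval \<open>[0, 1]\<close>. The sequence \<open>T \<omega>\<close> is nevertheless
  infinite: the arrivals in \<open>[0, 1]\<close> are those \<open>T k \<omega>\<close> with \<open>T k \<omega> \<le> 1\<close>, and the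
  later terms carry no information, only that there are no further arrivals.\<close>

definition arrival_count :: "(nat \<Rightarrow> 'a \<Rightarrow> real) \<Rightarrow> real \<Rightarrow> 'a \<Rightarrow> nat" where
  "arrival_count T t \<omega> = card {k. 1 \<le> k \<and> T k \<omega> \<le> t}"

locale poisson_arrivals = prob_space M for M :: "'a measure" +
  fixes rate :: real and T :: "nat \<Rightarrow> 'a \<Rightarrow> real"
  assumes rate_pos: "0 < rate"
    and epoch_measurable: "1 \<le> k \<Longrightarrow> random_variable borel (T k)"
    and epoch_pos: "\<omega> \<in> space M \<Longrightarrow> 0 < T 1 \<omega>"
    and epochs_increasing: "\<omega> \<in> space M \<Longrightarrow> strict_mono_on {1..} (\<lambda>k. T k \<omega>)"
    and finitely_many_arrivals: "\<omega> \<in> space M \<Longrightarrow> finite {k. 1 \<le> k \<and> T k \<omega> \<le> 1}"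
    and poisson_increments:
      "0 \<le> s \<Longrightarrow> s < t \<Longrightarrow> t \<le> 1 \<Longrightarrow>
        distr M (count_space UNIV) (\<lambda>\<omega>. arrival_count T t \<omega> - arrival_count T s \<omega>)
          = measure_pmf (poisson_pmf (rate * (t - s)))"
    and independent_increments:
      "0 \<le> u 0 \<Longrightarrow> u n \<le> 1 \<Longrightarrow> strict_mono_on {..n} u \<Longrightarrow>
        indep_vars (\<lambda>_. count_space UNIV)
          (\<lambda>i \<omega>. arrival_count T (u (Suc i)) \<omega> - arrival_count T (u i) \<omega>) {..<n::nat}"

definition arrival_events :: "'a measure \<Rightarrow> (nat \<Rightarrow> 'a \<Rightarrow> real) \<Rightarrow> real \<Rightarrow> 'a set set" where
  "arrival_events M T t = {{\<omega> \<in> space M. T k \<omega> \<le> s} | k s. 1 \<le> k \<and> 0 \<le> s \<and> s \<le> t}"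

definition success_events ::
  "'a measure \<Rightarrow> (nat \<Rightarrow> 'a \<Rightarrow> real) \<Rightarrow> (nat \<Rightarrow> 'a \<Rightarrow> bool) \<Rightarrow> real \<Rightarrow> 'a set set" where
  "success_events M T X t =
     {{\<omega> \<in> space M. T k \<omega> \<le> s \<and> X k \<omega>} | k s. 1 \<le> k \<and> 0 \<le> s \<and> s \<le> t}"

definition observed ::
  "'a measure \<Rightarrow> (nat \<Rightarrow> 'a \<Rightarrow> real) \<Rightarrow> (nat \<Rightarrow> 'a \<Rightarrow> bool) \<Rightarrow> real \<Rightarrow> 'a measure" where
  "observed M T X t = sigma (space M) (arrival_events M T t \<union> success_events M T X t)"

locale last_success_problem = poisson_arrivals M rate T
  for M :: "'a measure" and rate :: real and T :: "nat \<Rightarrow> 'a \<Rightarrow> real" +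
  fixes \<theta> :: real and X :: "nat \<Rightarrow> 'a \<Rightarrow> bool"
  assumes theta_pos: "0 < \<theta>"
    and marks_independent: "indep_vars (\<lambda>_. count_space UNIV) X {1..}"
    and mark_distribution:
      "1 \<le> k \<Longrightarrow>
        distr M (count_space UNIV) (X k) = measure_pmf (bernoulli_pmf (\<theta> / (\<theta> + real k - 1)))"
    and marks_independent_of_arrivals:
      "indep_set (sigma_sets (space M) (arrival_events M T 1))
                 (sigma_sets (space M) {{\<omega> \<in> space M. X k \<omega>} | k. 1 \<le> k})"

definition stopping_strategy ::
  "'a measure \<Rightarrow> (nat \<Rightarrow> 'a \<Rightarrow> real) \<Rightarrow> (nat \<Rightarrow> 'a \<Rightarrow> bool) \<Rightarrow> ('a \<Rightarrow> real) \<Rightarrow> bool" where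
  "stopping_strategy M T X \<tau> \<longleftrightarrow>
     \<tau> \<in> borel_measurable M \<and>
     (\<forall>\<omega>\<in>space M. \<tau> \<omega> \<in> {T k \<omega> | k. 1 \<le> k \<and> k \<le> arrival_count T 1 \<omega>} \<union> {1}) \<and>
     stopping_time (observed M T X) \<tau>"

text \<open>The value 1 of a strategy means not stopping, hence the strict inequality \<open>T k \<omega> < 1\<close>;
  an arrival at time 1 has probability 0.\<close>

definition win_event ::
  "'a measure \<Rightarrow> (nat \<Rightarrow> 'a \<Rightarrow> real) \<Rightarrow> (nat \<Rightarrow> 'a \<Rightarrow> bool) \<Rightarrow> ('a \<Rightarrow> real) \<Rightarrow> 'a set" where
  "win_event M T X \<tau> =
     {\<omega> \<in> space M. \<exists>k\<ge>1. T k \<omega> < 1 \<and> \<tau> \<omega> = T k \<omega> \<and> X k \<omega> \<and>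
        \<not> (\<exists>j\<ge>1. T k \<omega> < T j \<omega> \<and> T j \<omega> \<le> 1 \<and> X j \<omega>)}"

definition optimal_strategy ::
  "'a measure \<Rightarrow> (nat \<Rightarrow> 'a \<Rightarrow> real) \<Rightarrow> (nat \<Rightarrow> 'a \<Rightarrow> bool) \<Rightarrow> ('a \<Rightarrow> real) \<Rightarrow> bool" where
  "optimal_strategy M T X \<tau> \<longleftrightarrow>
     stopping_strategy M T X \<tau> \<and>
     (\<forall>\<sigma>. stopping_strategy M T X \<sigma> \<longrightarrow>
        measure M (win_event M T X \<sigma>) \<le> measure M (win_event M T X \<tau>))"

definition threshold_success ::
  "real \<Rightarrow> (nat \<Rightarrow> real) \<Rightarrow> (nat \<Rightarrow> 'a \<Rightarrow> real) \<Rightarrow> (nat \<Rightarrow> 'a \<Rightarrow> bool) \<Rightarrow> 'a \<Rightarrow> nat \<Rightarrow> bool" where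
  "threshold_success rate \<gamma> T X \<omega> k \<longleftrightarrow>
     1 \<le> k \<and> T k \<omega> \<le> 1 \<and> X k \<omega> \<and> (1 - T k \<omega>) * rate \<le> \<gamma> k"

text \<open>As the epochs increase, the least index gives the first such success.\<close>

definition threshold_rule ::
  "real \<Rightarrow> (nat \<Rightarrow> real) \<Rightarrow> (nat \<Rightarrow> 'a \<Rightarrow> real) \<Rightarrow> (nat \<Rightarrow> 'a \<Rightarrow> bool) \<Rightarrow> 'a \<Rightarrow> real" where
  "threshold_rule rate \<gamma> T X \<omega> =
     (if \<exists>k. threshold_success rate \<gamma> T X \<omega> k
      then T (LEAST k. threshold_success rate \<gamma> T X \<omega> k) \<omega> else 1)"

end

theory Submission
  imports Defs
begin

text \<open>The equation for \<open>\<gamma>\<^sub>k\<close> is a power series in \<open>x\<close> whose coefficients change sign once, from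
  negative to positive, so it has exactly one positive root. The roots increase because
  \<open>D\<^sub>aM(k, \<theta> + k, x) / M(k, \<theta> + k, x)\<close> decreases in \<open>k\<close>: after cross-multiplication and symmetrisation,
  each coefficient of the Cauchy product is a sum of comonotone sequences against positive weights,
  and Chebyshev's sum inequality applies because one of the two sequences has weighted sum zero.

  Let \<open>\<kappa>\<close> be the first good success, \<open>l\<close> the last and \<open>p\<close> the penultimate success, and let \<open>\<sigma>\<close> be the
  time of an arbitrary strategy. On every path
  \<open>1[\<sigma> = T\<^sub>l] \<le> 1[\<kappa> = l] + (1[\<kappa> \<le> p, T\<^sub>p < \<sigma>] - 1[\<kappa> \<le> l, T\<^sub>l < \<sigma>])
    + (1[\<sigma> \<le> T\<^sub>l, l < \<kappa>] - 1[\<sigma> \<le> T\<^sub>p, p < \<kappa>])\<close>.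
  Both brackets have nonpositive expectation: they compare "exactly one later success" with "no
  later success" on events known at a success epoch, which is good in the first bracket (good states
  are never left, by monotonicity of \<open>\<gamma>\<close>) and not good in the second. The Markov property at the
  random epochs follows from the one at fixed times by approximation along a grid.\<close>

section \<open>The series of Kummer's function and of its parameter derivative\<close>

text \<open>Passing over a success k to wait for the next one replaces the payoff 1[k = l] by
  1[k = p]. Summed over any set of successes, these exchanges collapse to their terms at l and p.
  This is the origin of the two brackets: the first collects the exchanges at the successes from
  \<kappa> on that \<sigma> passes, the second undoes the exchanges at the successes before \<kappa>
  that come at or after \<sigma>. An arbitrary strategy is thus compared with the rule in a single
  step, whereas backward induction would have no starting point, the number of arrivals being
  unbounded.

  The zero weighted sum also has a source. If the factors (c)_j are dropped, M(a, c, x) becomes (1 -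
  x)^(-a), whose logarithmic derivative in a is -log(1 - x), independent of a. The cross-multiplied
  difference then vanishes in every degree, so the sign is decided by the denominators (c)_j alone,
  and these favour the middle of the index range.\<close>

definition kummer_coeff :: "real \<Rightarrow> real \<Rightarrow> nat \<Rightarrow> real" where
  "kummer_coeff a c j = pochhammer a j / (pochhammer c j * fact j)"

text \<open>The logarithmic derivative of \<open>pochhammer a j\<close> in \<open>a\<close>, that is
  \<psi>(a + j) - \<psi>(a) for the digamma function \<psi>.\<close>

definition shifted_harmonic :: "real \<Rightarrow> nat \<Rightarrow> real" where
  "shifted_harmonic a j = (\<Sum>i<j. 1 / (a + real i))"

lemma shifted_harmonic_0 [simp]: "shifted_harmonic a 0 = 0"
  and shifted_harmonic_Suc: "shifted_harmonic a (Suc j) = shifted_harmonic a j + 1 / (a + real j)"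
  by (simp_all add: shifted_harmonic_def)

lemma shifted_harmonic_mono: "0 < a \<Longrightarrow> i \<le> j \<Longrightarrow> shifted_harmonic a i \<le> shifted_harmonic a j"
  unfolding shifted_harmonic_def by (intro sum_mono2) auto

lemma shifted_harmonic_nonneg: "0 < a \<Longrightarrow> 0 \<le> shifted_harmonic a j"
  using shifted_harmonic_mono[of a 0 j] by simp

lemma shifted_harmonic_shift:
  "0 < a \<Longrightarrow> shifted_harmonic (a + 1) j = shifted_harmonic a (Suc j) - 1 / a"
  by (induction j) (simp_all add: shifted_harmonic_Suc add_ac)

text \<open>The true growth is logarithmic, but a geometric bound has the convenient shape:
  \<open>2 ^ j\<close> merges with the geometric factor in the majorant of the coefficients.\<close>

lemma shifted_harmonic_le: "0 < a \<Longrightarrow> shifted_harmonic a j \<le> 2 ^ j / a"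
proof (induction j)
  case (Suc j)
  have "shifted_harmonic a (Suc j) \<le> 2 ^ j / a + 1 / a"
    using Suc by (auto simp: shifted_harmonic_Suc intro!: add_mono divide_left_mono)
  also have "\<dots> \<le> 2 ^ j / a + 2 ^ j / a"
    using Suc.prems by (intro add_left_mono divide_right_mono) auto
  also have "\<dots> = 2 ^ Suc j / a"
    by simp
  finally show ?case .
qed simp

text \<open>Divergence of the harmonic series makes the coefficients of the root equation eventually
  positive for every \<theta>, however small, so that a root exists.\<close>

lemma filterlim_shifted_harmonic:
  assumes "0 < a"
  shows "filterlim (shifted_harmonic a) at_top sequentially"
proof -
  have "\<not> summable (\<lambda>i. 1 / (a + real i))"
  proof
    assume s: "summable (\<lambda>i. 1 / (a + real i))"
    obtain m :: nat where m: "a \<le> real m"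
      using real_arch_simple by blast
    have "summable (\<lambda>i. inverse (real (i + (m + 1))))"
      by (rule summable_comparison_test'[OF s])
        (use assms m in \<open>auto simp: field_simps\<close>)
    then have "summable (\<lambda>i. inverse (real i))"
      using summable_iff_shift by blast
    then show False
      using not_summable_harmonic[where 'a = real] by simp
  qed
  moreover have "summable (\<lambda>i. 1 / (a + real i))" if B: "\<And>j. shifted_harmonic a j \<le> B" for B
    by (rule summableI_nonneg_bounded[where x = B])
      (use assms B in \<open>auto simp: shifted_harmonic_def\<close>)
  ultimately have unb: "\<exists>j. B < shifted_harmonic a j" for B
    by (meson not_le)
  show ?thesis
    unfolding filterlim_at_top
  proof
    fix B
    obtain j where "B < shifted_harmonic a j"
      using unb by blast
    then show "\<forall>\<^sub>F i in sequentially. B \<le> shifted_harmonic a i"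
      unfolding eventually_sequentially
      by (intro exI[of _ j]) (meson assms less_imp_le order_trans shifted_harmonic_mono)
  qed
qed

section \<open>Convergence and termwise differentiation in the parameter\<close>

lemma kummer_coeff_pos: "0 < a \<Longrightarrow> 0 < c \<Longrightarrow> 0 < kummer_coeff a c j"
  by (simp add: kummer_coeff_def pochhammer_pos)

lemma kummer_coeff_0 [simp]: "kummer_coeff a c 0 = 1"
  by (simp add: kummer_coeff_def)

text \<open>Each ratio (a + j) / (c + j) lies between a / c and 1, so the larger of the two bounds
  every factor.\<close>

lemma kummer_coeff_le:
  assumes "0 < a" "0 < c"
  shows "kummer_coeff a c j \<le> max 1 (a / c) ^ j / fact j"
proof -
  have "pochhammer a j / pochhammer c j \<le> max 1 (a / c) ^ j"
  proof (induction j)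
    case (Suc j)
    have "a + real j \<le> max 1 (a / c) * (c + real j)"
    proof (cases "a \<le> c")
      case True
      then have "max 1 (a / c) = 1"
        using assms by (simp add: max_def divide_le_eq)
      with True show ?thesis by simp
    next
      case False
      then have "max 1 (a / c) = a / c" "1 \<le> a / c"
        using assms by (auto simp: max_def)
      moreover have "1 * real j \<le> (a / c) * real j"
        using \<open>1 \<le> a / c\<close> by (intro mult_right_mono) auto
      ultimately show ?thesis
        using assms by (simp add: distrib_left)
    qed
    then have q: "(a + real j) / (c + real j) \<le> max 1 (a / c)"
      using assms by (simp add: divide_le_eq)
    have "pochhammer a (Suc j) / pochhammer c (Suc j) =
        pochhammer a j / pochhammer c j * ((a + real j) / (c + real j))"
      by (simp add: pochhammer_Suc)
    also have "\<dots> \<le> max 1 (a / c) ^ j * max 1 (a / c)"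
      using Suc.IH q assms
      by (intro mult_mono) (auto intro!: divide_nonneg_nonneg simp: pochhammer_nonneg)
    finally show ?case
      by (simp add: mult.commute)
  qed simp
  then have "pochhammer a j / pochhammer c j / fact j \<le> max 1 (a / c) ^ j / fact j"
    by (rule divide_right_mono) simp
  then show ?thesis
    by (simp add: kummer_coeff_def)
qed

text \<open>One comparison with the exponential series that serves M, D_aM and the Poisson mixtures
  \<open>later_prob\<close>.\<close>

lemma summable_norm_exp_bound:
  fixes f :: "nat \<Rightarrow> real"
  assumes "\<And>j. \<bar>f j\<bar> \<le> B * K ^ j / fact j"
  shows "summable (\<lambda>j. norm (f j * x ^ j))"
proof (rule summable_comparison_test')
  show "summable (\<lambda>j. B * ((K * \<bar>x\<bar>) ^ j / fact j))"
    using summable_exp[of "K * \<bar>x\<bar>"] by (intro summable_mult) (simp add: field_simps)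
  show "norm (norm (f j * x ^ j)) \<le> B * ((K * \<bar>x\<bar>) ^ j / fact j)" if "0 \<le> j" for j
    using mult_right_mono[OF assms[of j], of "\<bar>x ^ j\<bar>"]
    by (simp add: abs_mult power_abs power_mult_distrib)
qed

lemma summable_kummer:
  assumes "0 < a" "0 < c"
  shows "summable (\<lambda>j. norm (kummer_coeff a c j * x ^ j))"
proof (rule summable_norm_exp_bound[where B = 1])
  show "\<bar>kummer_coeff a c j\<bar> \<le> 1 * max 1 (a / c) ^ j / fact j" for j
    using kummer_coeff_le[OF assms, of j] kummer_coeff_pos[OF assms, of j] by simp
qed

lemma summable_kummer_da:
  assumes "0 < a" "0 < c"
  shows "summable (\<lambda>j. norm (kummer_coeff a c j * shifted_harmonic a j * x ^ j))"
proof (rule summable_norm_exp_bound[where B = "1 / a"])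
  show "\<bar>kummer_coeff a c j * shifted_harmonic a j\<bar> \<le> 1 / a * (2 * max 1 (a / c)) ^ j / fact j" for j
  proof -
    have "kummer_coeff a c j * shifted_harmonic a j \<le> (max 1 (a / c) ^ j / fact j) * (2 ^ j / a)"
      using kummer_coeff_le[OF assms, of j] kummer_coeff_pos[OF assms, of j]
        shifted_harmonic_le[of a j] shifted_harmonic_nonneg[of a j] assms
      by (intro mult_mono) auto
    then show ?thesis
      using kummer_coeff_pos[OF assms, of j] shifted_harmonic_nonneg[of a j] assms
      by (simp add: abs_mult power_mult_distrib field_simps)
  qed
qed

lemma kummer_eq: "kummer a c x = (\<Sum>j. kummer_coeff a c j * x ^ j)"
  by (simp add: kummer_def kummer_coeff_def)

lemma has_field_derivative_pochhammer:
  fixes b :: real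
  assumes "0 < b"
  shows "((\<lambda>b. pochhammer b j) has_field_derivative pochhammer b j * shifted_harmonic b j)
     (at b within S)"
proof (induction j)
  case (Suc j)
  have "((\<lambda>b. pochhammer b j * (b + real j)) has_field_derivative
      pochhammer b j * 1 + (pochhammer b j * shifted_harmonic b j) * (b + real j)) (at b within S)"
    using Suc by (intro DERIV_mult') (auto intro!: derivative_eq_intros)
  moreover have "pochhammer b j * 1 + (pochhammer b j * shifted_harmonic b j) * (b + real j) =
      pochhammer b (Suc j) * shifted_harmonic b (Suc j)"
    using assms by (simp add: pochhammer_Suc shifted_harmonic_Suc field_simps)
  ultimately show ?case
    by (simp only: pochhammer_Suc)
qed simp

text \<open>The product is the derivative of \<open>pochhammer b j\<close> in \<open>b\<close>, a
  polynomial with nonnegative coefficients, and therefore increases for positive arguments.\<close>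

lemma pochhammer_shifted_harmonic_mono:
  assumes "0 < a" "a \<le> b"
  shows "pochhammer a j * shifted_harmonic a j \<le> pochhammer b j * shifted_harmonic b j"
proof (induction j)
  case (Suc j)
  have mono: "pochhammer a j \<le> pochhammer b j"
    unfolding pochhammer_prod using assms by (intro prod_mono) auto
  have step: "pochhammer d (Suc j) * shifted_harmonic d (Suc j) =
      pochhammer d j * shifted_harmonic d j * (d + real j) + pochhammer d j" if "0 < d" for d
    using that by (simp add: pochhammer_Suc shifted_harmonic_Suc field_simps)
  have "0 \<le> pochhammer b j * shifted_harmonic b j"
    using assms by (intro mult_nonneg_nonneg shifted_harmonic_nonneg)
      (auto intro!: pochhammer_nonneg)
  then show ?case
    using assms mono Suc by (subst (1 2) step) (auto intro!: add_mono mult_mono)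
qed simp

lemma kummer_da_eq:
  assumes "0 < a" "0 < c"
  shows "kummer_da a c x = (\<Sum>j. kummer_coeff a c j * shifted_harmonic a j * x ^ j)"
proof -
  define f where "f n b = kummer_coeff b c n * x ^ n" for n b
  define f' where "f' n b = kummer_coeff b c n * shifted_harmonic b n * x ^ n" for n b
  have "((\<lambda>b. \<Sum>n. f n b) has_field_derivative (\<Sum>n. f' n a)) (at a)"
  proof (rule has_field_derivative_series'(2))
    \<comment> \<open>The interval is a neighbourhood of \<open>a\<close> that is bounded above: the
      derivative terms increase in the parameter, so their values at the right end
      \<open>a + 1\<close> form the Weierstrass majorant.\<close>
    show "convex {0<..<a + 1}"
      by simp
    show "(f n has_field_derivative f' n b) (at b within {0<..<a + 1})"
      if "b \<in> {0<..<a + 1}" for n b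
    proof -
      have "((\<lambda>b. pochhammer b n * (x ^ n / (pochhammer c n * fact n))) has_field_derivative
         pochhammer b n * shifted_harmonic b n * (x ^ n / (pochhammer c n * fact n)))
         (at b within {0<..<a + 1})"
        using that by (intro DERIV_cmult_right has_field_derivative_pochhammer) auto
      then show ?thesis
        unfolding f_def f'_def kummer_coeff_def by (simp add: field_simps)
    qed
    show "uniformly_convergent_on {0<..<a + 1} (\<lambda>n b. \<Sum>i<n. f' i b)"
    proof (rule Weierstrass_m_test'[rotated])
      show "summable (\<lambda>n. norm (f' n (a + 1)))"
        unfolding f'_def using summable_kummer_da[of "a + 1" c x] assms by simp
      show "norm (f' n b) \<le> norm (f' n (a + 1))" if "b \<in> {0<..<a + 1}" for n b
      proof -
        have eq: "norm (f' n b) =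
            pochhammer b n * shifted_harmonic b n * (\<bar>x\<bar> ^ n / (pochhammer c n * fact n))"
          if "0 < b" for b
          using that assms pochhammer_pos[of b n] pochhammer_pos[of c n]
            shifted_harmonic_nonneg[of b n]
          by (simp add: f'_def kummer_coeff_def abs_mult power_abs)
        have "0 < b" "0 < a + 1"
          using that assms by auto
        then show ?thesis
          unfolding eq[OF \<open>0 < b\<close>] eq[OF \<open>0 < a + 1\<close>]
          using that assms pochhammer_shifted_harmonic_mono[of b "a + 1" n] pochhammer_pos[of c n]
          by (intro mult_right_mono) auto
      qed
    qed
    show "a \<in> {0<..<a + 1}" "a \<in> interior {0<..<a + 1}"
      using assms by auto
    show "summable (\<lambda>n. f n a)"
      unfolding f_def using summable_norm_cancel[OF summable_kummer[OF assms]] .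
  qed
  then show ?thesis
    unfolding kummer_da_def kummer_eq f_def f'_def by (rule DERIV_imp_deriv)
qed

section \<open>Uniqueness of the root\<close>

text \<open>After division of the series by x^J every term is nondecreasing: below J a nonpositive
  coefficient meets a negative exponent, from J on a positive coefficient meets a nonnegative one.
  The constant term makes the quotient strictly increasing, so it has at most one zero. The
  inequality \<open>scale\<close> is this monotonicity with denominators cleared.\<close>

lemma power_series_single_sign_change:
  fixes d :: "nat \<Rightarrow> real"
  assumes summable: "\<And>x. summable (\<lambda>j. d j * x ^ j)"
    and d0: "d 0 < 0" and neg: "\<And>j. j < J \<Longrightarrow> d j \<le> 0" and pos: "\<And>j. J \<le> j \<Longrightarrow> 0 < d j"
  obtains r where "0 < r" "(\<Sum>j. d j * r ^ j) = 0"
    "\<And>x. 0 < x \<Longrightarrow> x < r \<Longrightarrow> (\<Sum>j. d j * x ^ j) < 0"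
    "\<And>x. r < x \<Longrightarrow> 0 < (\<Sum>j. d j * x ^ j)"
proof -
  define F where "F x = (\<Sum>j. d j * x ^ j)" for x
  have "0 < J"
    using d0 pos[of 0] by (cases J) auto
  have scale: "(y / x) ^ J * F x < F y" if "0 < x" "x < y" for x y
  proof -
    have s: "summable (\<lambda>j. (y / x) ^ J * (d j * x ^ j))"
      using summable by (rule summable_mult)
    have diff: "d j * y ^ j - (y / x) ^ J * (d j * x ^ j) = d j * x ^ j * ((y / x) ^ j - (y / x) ^ J)" for j
      using that by (simp add: field_simps)
    have ge: "1 \<le> y / x"
      using that by simp
    have nonneg: "0 \<le> d j * y ^ j - (y / x) ^ J * (d j * x ^ j)" for j
    proof (cases "j < J")
      case True
      then have "(y / x) ^ j \<le> (y / x) ^ J"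
        using ge by (intro power_increasing) auto
      then show ?thesis
        unfolding diff using neg[OF True] that
        by (intro mult_nonpos_nonpos) (auto intro!: mult_nonpos_nonneg)
    next
      case False
      then have "(y / x) ^ J \<le> (y / x) ^ j"
        using ge by (intro power_increasing) auto
      then show ?thesis
        unfolding diff using pos[of j] False that
        by (intro mult_nonneg_nonneg) auto
    qed
    have "1 < (y / x) ^ J"
      using that \<open>0 < J\<close> by (intro one_less_power) auto
    then have "0 < d 0 * y ^ 0 - (y / x) ^ J * (d 0 * x ^ 0)"
      using d0 by simp
    then have "0 < (\<Sum>j. d j * y ^ j - (y / x) ^ J * (d j * x ^ j))"
      by (intro suminf_pos2[of _ 0] summable_diff summable s nonneg)
    also have "\<dots> = F y - (y / x) ^ J * F x"
      unfolding F_def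
      by (subst suminf_diff[symmetric, OF summable s]) (simp add: suminf_mult[OF summable])
    finally show ?thesis
      by simp
  qed
  have "isCont F x" for x
    unfolding F_def by (rule isCont_powser_converges_everywhere[OF summable])
  then have cont: "continuous_on S F" for S
    by (simp add: continuous_at_imp_continuous_on)
  have F0: "F 0 < 0"
    using d0 powser_zero[of d] by (simp add: F_def)
  \<comment> \<open>A Cauchy bound: here \<open>d J * y ^ J\<close> equals (d J + \<Sum> |d j|) y^(J
    - 1), which outweighs the terms below J, each of size at most |d j| y^(J - 1) because y \<ge>
    1.\<close>
  define y where "y = 1 + (\<Sum>j<J. \<bar>d j\<bar>) / d J"
  have dJ: "0 < d J"
    using pos by simp
  have y1: "1 \<le> y"
    using dJ by (simp add: y_def sum_nonneg)
  have "0 < F y"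
  proof -
    obtain i where i: "J = Suc i"
      using \<open>0 < J\<close> by (cases J) auto
    have "- (\<Sum>j<J. \<bar>d j\<bar>) * y ^ i = (\<Sum>j<J. - (\<bar>d j\<bar> * y ^ i))"
      by (simp add: sum_distrib_right sum_negf)
    also have "\<dots> \<le> (\<Sum>j<J. d j * y ^ j)"
    proof (rule sum_mono)
      fix j assume "j \<in> {..<J}"
      then have "\<bar>d j\<bar> * y ^ j \<le> \<bar>d j\<bar> * y ^ i"
        using y1 i by (intro mult_left_mono power_increasing) auto
      moreover have "- \<bar>d j\<bar> * y ^ j \<le> d j * y ^ j"
        using y1 by (intro mult_right_mono) auto
      ultimately show "- (\<bar>d j\<bar> * y ^ i) \<le> d j * y ^ j"
        by simp
    qed
    finally have low: "- (\<Sum>j<J. \<bar>d j\<bar>) * y ^ i \<le> (\<Sum>j<J. d j * y ^ j)" .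
    have "d J * y ^ J = (d J + (\<Sum>j<J. \<bar>d j\<bar>)) * y ^ i"
      using dJ by (simp add: i y_def field_simps)
    then have "0 < (\<Sum>j<J. d j * y ^ j) + d J * y ^ J"
      using low dJ y1 by (simp add: ring_distribs) (smt (verit) mult_pos_pos zero_less_power)
    also have "\<dots> = (\<Sum>j\<in>{..<Suc J}. d j * y ^ j)"
      by simp
    also have "\<dots> \<le> F y"
      unfolding F_def using pos y1
      by (intro sum_le_suminf summable) (auto simp: less_imp_le)
    finally show ?thesis .
  qed
  then obtain r where r: "0 \<le> r" "r \<le> y" "F r = 0"
    using IVT'[of F 0 0 y] F0 y1 cont by auto
  have "0 < r"
    using r F0 by (cases "r = 0") auto
  show ?thesis
  proof (rule that[OF \<open>0 < r\<close>])
    show "(\<Sum>j. d j * r ^ j) = 0"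
      using r by (simp add: F_def)
    show "(\<Sum>j. d j * x ^ j) < 0" if "0 < x" "x < r" for x
    proof -
      have "0 < (r / x) ^ J" "(r / x) ^ J * F x < 0"
        using scale[OF that] r that \<open>0 < r\<close> by simp_all
      then have "F x < 0"
        by (meson less_imp_le mult_nonneg_nonneg not_less)
      then show ?thesis
        by (simp add: F_def)
    qed
    show "0 < (\<Sum>j. d j * x ^ j)" if "r < x" for x
      using scale[OF \<open>0 < r\<close> that] r by (simp add: F_def)
  qed
qed

lemma kummer_equation_sign_change:
  assumes "0 < a" "0 < c" "0 < \<theta>"
  obtains r where "0 < r" "\<theta> * kummer_da a c r - kummer a c r = 0"
    "\<And>x. 0 < x \<Longrightarrow> x < r \<Longrightarrow> \<theta> * kummer_da a c x - kummer a c x < 0"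
    "\<And>x. r < x \<Longrightarrow> 0 < \<theta> * kummer_da a c x - kummer a c x"
proof -
  define d where "d j = kummer_coeff a c j * (\<theta> * shifted_harmonic a j - 1)" for j
  have sums: "summable (\<lambda>j. d j * x ^ j)"
    and eq: "\<theta> * kummer_da a c x - kummer a c x = (\<Sum>j. d j * x ^ j)" for x
  proof -
    have s: "summable (\<lambda>j. kummer_coeff a c j * x ^ j)"
      "summable (\<lambda>j. kummer_coeff a c j * shifted_harmonic a j * x ^ j)"
      using summable_norm_cancel[OF summable_kummer] summable_norm_cancel[OF summable_kummer_da]
        assms by auto
    have eq: "d j * x ^ j = \<theta> * (kummer_coeff a c j * shifted_harmonic a j * x ^ j) -
      kummer_coeff a c j * x ^ j" for j
      by (simp add: d_def algebra_simps)
    show "summable (\<lambda>j. d j * x ^ j)"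
      unfolding eq by (intro summable_diff summable_mult s)
    show "\<theta> * kummer_da a c x - kummer a c x = (\<Sum>j. d j * x ^ j)"
      unfolding eq
      by (subst suminf_diff[symmetric])
        (use assms in \<open>auto intro!: summable_mult s simp: suminf_mult s kummer_da_eq kummer_eq\<close>)
  qed
  \<comment> \<open>The coefficient \<open>d j\<close> has the sign of \<theta> H_j - 1, and H_j
    increases in j. The strict inequality makes all coefficients from \<open>J\<close> on strictly
    positive, while one before \<open>J\<close> may vanish.\<close>
  define J where "J = (LEAST j. 1 / \<theta> < shifted_harmonic a j)"
  have "\<exists>j. 1 / \<theta> < shifted_harmonic a j"
    using filterlim_shifted_harmonic[OF assms(1)]
    unfolding filterlim_at_top_dense eventually_sequentially by blast
  then have J: "1 / \<theta> < shifted_harmonic a J"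
    unfolding J_def by (rule LeastI_ex)
  have "d 0 < 0"
    by (simp add: d_def)
  moreover have "d j \<le> 0" if "j < J" for j
    using not_less_Least[OF that[unfolded J_def]] assms kummer_coeff_pos[OF assms(1,2), of j]
    unfolding d_def by (intro mult_nonneg_nonpos) (auto simp: field_simps not_less)
  moreover have "0 < d j" if "J \<le> j" for j
  proof -
    have "1 / \<theta> < shifted_harmonic a j"
      using J shifted_harmonic_mono[OF assms(1) that] by simp
    then show ?thesis
      using assms kummer_coeff_pos[OF assms(1,2), of j] by (simp add: d_def field_simps)
  qed
  ultimately obtain r where "0 < r" "(\<Sum>j. d j * r ^ j) = 0"
    "\<And>x. 0 < x \<Longrightarrow> x < r \<Longrightarrow> (\<Sum>j. d j * x ^ j) < 0"
    "\<And>x. r < x \<Longrightarrow> 0 < (\<Sum>j. d j * x ^ j)"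
    using power_series_single_sign_change[OF sums] by blast
  then show ?thesis
    using that by (simp add: eq)
qed

lemma kummer_root_properties:
  assumes "0 < \<theta>" "1 \<le> k"
  shows kummer_root_unique: "\<exists>!x. is_kummer_root \<theta> k x"
    and kummer_root_pos: "0 < kummer_root \<theta> k"
    and kummer_root_below: "0 < x \<Longrightarrow> x \<le> kummer_root \<theta> k \<Longrightarrow>
      \<theta> * kummer_da (real k) (\<theta> + real k) x \<le> kummer (real k) (\<theta> + real k) x"
    and kummer_root_above: "kummer_root \<theta> k \<le> x \<Longrightarrow>
      kummer (real k) (\<theta> + real k) x \<le> \<theta> * kummer_da (real k) (\<theta> + real k) x"
proof -
  define G where "G x = \<theta> * kummer_da (real k) (\<theta> + real k) x - kummer (real k) (\<theta> + real k) x"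
    for x
  obtain r where r: "0 < r" "G r = 0" "\<And>x. 0 < x \<Longrightarrow> x < r \<Longrightarrow> G x < 0" "\<And>x. r < x \<Longrightarrow> 0 < G x"
    using kummer_equation_sign_change[of "real k" "\<theta> + real k" \<theta>] assms unfolding G_def by auto
  have iff: "is_kummer_root \<theta> k x \<longleftrightarrow> x = r" for x
    unfolding is_kummer_root_def G_def[symmetric]
    using r(1,2) r(3,4)[of x] by (cases x r rule: linorder_cases) auto
  then have root: "kummer_root \<theta> k = r"
    by (simp add: kummer_root_def)
  show "\<exists>!x. is_kummer_root \<theta> k x"
    by (simp add: iff)
  show "0 < kummer_root \<theta> k"
    using r root by simp
  have "G x \<le> 0" if "0 < x" "x \<le> r"
    using r(2) r(3)[of x] that by (cases "x = r") auto
  then show "0 < x \<Longrightarrow> x \<le> kummer_root \<theta> k \<Longrightarrow>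
      \<theta> * kummer_da (real k) (\<theta> + real k) x \<le> kummer (real k) (\<theta> + real k) x"
    by (simp add: root G_def)
  have "0 \<le> G x" if "r \<le> x"
    using r(2) r(4)[of x] that by (cases "x = r") auto
  then show "kummer_root \<theta> k \<le> x \<Longrightarrow>
      kummer (real k) (\<theta> + real k) x \<le> \<theta> * kummer_da (real k) (\<theta> + real k) x"
    by (simp add: root G_def)
qed

section \<open>Monotonicity in the parameter\<close>

text \<open>The termwise form of M'(a, c, x) = (a / c) M(a + 1, c + 1, x). Passing from k to k + 1
  raises both parameters k and \<theta> + k by one, so neighbouring roots concern a series and its
  derivative in x.\<close>

lemma kummer_coeff_shift:
  assumes "0 < a" "0 < c"
  shows "kummer_coeff (a + 1) (c + 1) j = c / a * (real (Suc j) * kummer_coeff a c (Suc j))"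
proof -
  have "pochhammer c (Suc j) \<noteq> 0"
    using assms pochhammer_pos[of c "Suc j"] by simp
  then have "pochhammer (c + 1) j \<noteq> 0"
    by (simp add: pochhammer_rec)
  then show ?thesis
    using assms by (simp add: kummer_coeff_def pochhammer_rec divide_simps del: of_nat_Suc)
qed

lemma sum_atMost_reflect: "(\<Sum>j\<le>N. f (N - j)) = (\<Sum>j\<le>N. f j)" for N :: nat
  by (rule sum.reindex_bij_witness[of _ "\<lambda>j. N - j" "\<lambda>j. N - j"]) auto

text \<open>The double sum of V i V j (s i - s j) (F i - F j) is twice the difference of the two
  sides. Comonotonicity is stated pairwise, without an order on \<open>A\<close>, because the
  sequences it is applied to rise up to the middle of the index range and then fall.\<close>

lemma chebyshev_sum_weighted:
  fixes V s F :: "'b \<Rightarrow> real"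
  assumes V: "\<And>i. i \<in> A \<Longrightarrow> 0 \<le> V i"
    and comonotone: "\<And>i j. i \<in> A \<Longrightarrow> j \<in> A \<Longrightarrow> 0 \<le> (s i - s j) * (F i - F j)"
  shows "(\<Sum>i\<in>A. V i * s i) * (\<Sum>i\<in>A. V i * F i) \<le> (\<Sum>i\<in>A. V i) * (\<Sum>i\<in>A. V i * s i * F i)"
proof -
  have "0 \<le> (\<Sum>i\<in>A. \<Sum>j\<in>A. V i * V j * ((s i - s j) * (F i - F j)))"
    by (intro sum_nonneg mult_nonneg_nonneg[OF mult_nonneg_nonneg] V comonotone)
  also have "\<dots> = (\<Sum>i\<in>A. \<Sum>j\<in>A. (V i * s i * F i) * V j + V i * (V j * s j * F j)
      - (V i * s i) * (V j * F j) - (V i * F i) * (V j * s j))"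
    by (intro sum.cong refl) (simp add: algebra_simps)
  also have "\<dots> = (\<Sum>i\<in>A. \<Sum>j\<in>A. (V i * s i * F i) * V j) + (\<Sum>i\<in>A. \<Sum>j\<in>A. V i * (V j * s j * F j))
      - (\<Sum>i\<in>A. \<Sum>j\<in>A. (V i * s i) * (V j * F j)) - (\<Sum>i\<in>A. \<Sum>j\<in>A. (V i * F i) * (V j * s j))"
    by (simp only: sum.distrib sum_subtractf)
  also have "\<dots> = 2 * ((\<Sum>i\<in>A. V i) * (\<Sum>i\<in>A. V i * s i * F i)) -
      2 * ((\<Sum>i\<in>A. V i * s i) * (\<Sum>i\<in>A. V i * F i))"
    by (simp add: sum_product[symmetric])
  finally show ?thesis
    by simp
qed

section \<open>Coefficients of the cross-multiplied difference in a fixed degree\<close>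

context
  fixes a :: real and N :: nat
  assumes a: "0 < a"
begin

private abbreviation H where "H \<equiv> shifted_harmonic a"

private definition V where
  "V j = pochhammer a j * pochhammer a (N - j) / (fact j * fact (N - j))"

text \<open>The factor (N - j) (H_j - H_(N - j) + 1 / a) of the Cauchy product, added to its mirror
  image under j -> N - j.\<close>

private definition s where
  "s j = real N / a - (real (N - j) - real j) * (H (N - j) - H j)"

private lemma V_nonneg: "0 \<le> V j"
  using a by (simp add: V_def pochhammer_nonneg)

text \<open>\<open>V\<close> is proportional to the Dirichlet-binomial weights, and this is their Stein identity.\<close>

private lemma V_summation_by_parts:
  "(\<Sum>j\<le>N. V j * (real (N - j) * (a + real j) * \<phi> j)) =
   (\<Sum>j\<le>N. V j * (real j * (a + real (N - j)) * \<phi> (j - 1)))"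
proof (cases N)
  case (Suc n)
  have "V j * (real (N - j) * (a + real j) * \<phi> j) =
      V (Suc j) * (real (Suc j) * (a + real (N - Suc j)) * \<phi> j)" if "j \<le> n" for j
  proof -
    define m where "m = N - Suc j"
    have m: "N - j = Suc m" "N - Suc j = m"
      using Suc that by (simp_all add: m_def)
    show ?thesis
      unfolding V_def m by (simp add: pochhammer_Suc field_simps del: of_nat_Suc)
  qed
  then have "(\<Sum>j\<le>n. V j * (real (N - j) * (a + real j) * \<phi> j)) =
      (\<Sum>j\<le>n. V (Suc j) * (real (Suc j) * (a + real (N - Suc j)) * \<phi> (Suc j - 1)))"
    by (intro sum.cong) auto
  \<comment> \<open>The boundary terms vanish: the factor \<open>real (N - j)\<close> at
    \<open>j = N\<close>, and on the other side \<open>real j\<close> at \<open>j = 0\<close>, where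
    \<open>j - 1\<close> is truncated.\<close>
  moreover have "(\<Sum>j\<le>N. V j * (real (N - j) * (a + real j) * \<phi> j)) =
      (\<Sum>j\<le>n. V j * (real (N - j) * (a + real j) * \<phi> j))"
    by (simp add: Suc)
  ultimately show ?thesis
    unfolding Suc by (simp add: sum.atMost_Suc_shift del: sum.atMost_Suc)
qed simp

text \<open>The summation by parts is applied to \<phi> j = H (N - j) - H j and to 1 / (a + j). The
  increment \<phi> (j - 1) - \<phi> j is 1 / (a + N - j) + 1 / (a + j - 1): its first part cancels a
  factor and leaves \<open>V j * real j\<close>, its second part is turned into
  \<open>V j * real (N - j)\<close> by the second application.\<close>

private lemma sum_V_s: "(\<Sum>j\<le>N. V j * s j) = 0"
proof -
  define \<phi> where "\<phi> j = H (N - j) - H j" for j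
  have 1: "(\<Sum>j\<le>N. V j * (real (N - j) * (a + real j) * \<phi> j)) =
     (\<Sum>j\<le>N. V j * (real j * (a + real (N - j)) * \<phi> (j - 1)))"
    by (rule V_summation_by_parts)
  have 2: "(\<Sum>j\<le>N. V j * real (N - j)) =
     (\<Sum>j\<le>N. V j * (real j * (a + real (N - j)) * (1 / (a + real (j - 1)))))"
    using V_summation_by_parts[of "\<lambda>j. 1 / (a + real j)"] a by simp
  have rel: "V j * (real j * (a + real (N - j)) * \<phi> (j - 1)) =
      V j * (real j * (a + real (N - j)) * \<phi> j) + V j * real j
      + V j * (real j * (a + real (N - j)) * (1 / (a + real (j - 1))))" if "j \<le> N" for j
  proof (cases j)
    case (Suc i)
    have "N - i = Suc (N - j)"
      using Suc that by simp
    then have "\<phi> (j - 1) = \<phi> j + 1 / (a + real (N - j)) + 1 / (a + real (j - 1))"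
      by (simp add: \<phi>_def Suc shifted_harmonic_Suc)
    moreover have "v * (r * p * (f + 1 / p + q)) = v * (r * p * f) + v * r + v * (r * p * q)"
      if "p \<noteq> 0" for v r p f q :: real
      using that by (simp add: distrib_left)
    moreover have "a + real (N - j) \<noteq> 0"
      using a by simp
    ultimately show ?thesis
      by presburger
  qed simp
  have "(\<Sum>j\<le>N. V j * (real j * (a + real (N - j)) * \<phi> (j - 1))) =
      (\<Sum>j\<le>N. V j * (real j * (a + real (N - j)) * \<phi> j) + V j * real j + V j * real (N - j))"
    unfolding sum.distrib 2 unfolding sum.distrib[symmetric] by (intro sum.cong refl rel) simp
  then have "0 = (\<Sum>j\<le>N. V j * (real (N - j) * (a + real j) * \<phi> j) -
     (V j * (real j * (a + real (N - j)) * \<phi> j) + V j * real j + V j * real (N - j)))"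
    using 1 by (simp add: sum_subtractf)
  also have "\<dots> = (\<Sum>j\<le>N. - a * (V j * s j))"
  proof (rule sum.cong)
    fix j assume "j \<in> {..N}"
    then have "real (N - j) = real N - real j"
      by simp
    then show "V j * (real (N - j) * (a + real j) * \<phi> j) -
        (V j * (real j * (a + real (N - j)) * \<phi> j) + V j * real j + V j * real (N - j)) =
        - a * (V j * s j)"
      using a unfolding s_def \<phi>_def[symmetric] by (simp add: field_simps)
  qed simp
  also have "\<dots> = - a * (\<Sum>j\<le>N. V j * s j)"
    by (simp only: sum_distrib_left)
  finally show ?thesis
    using a by simp
qed

private definition F :: "real \<Rightarrow> nat \<Rightarrow> real" where
  "F c j = 1 / (pochhammer c j * pochhammer c (N - j))"

text \<open>Towards the middle, (N - j) - j and H (N - j) - H j both decrease and stay nonnegative,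
  hence so does the product that \<open>s\<close> subtracts.\<close>

private lemma s_mono: "i \<le> j \<Longrightarrow> 2 * j \<le> N \<Longrightarrow> s i \<le> s j"
  unfolding s_def using a shifted_harmonic_mono[of a i j]
    shifted_harmonic_mono[of a "N - j" "N - i"] shifted_harmonic_mono[of a "j" "N - j"]
  by (intro diff_mono mult_mono) auto

text \<open>One step towards the middle exchanges a factor c + m of the denominator for c + j with j
  \<le> m.\<close>

private lemma F_mono:
  assumes "0 < c" "i \<le> j" "2 * j \<le> N"
  shows "F c i \<le> F c j"
  using assms(2,3)
proof (induction j rule: dec_induct)
  case (step j)
  obtain m where m: "N - j = Suc m" "N - Suc j = m" "j \<le> m"
    using step.prems by (intro that[of "N - Suc j"]) auto
  have pos: "0 < pochhammer c j" "0 < pochhammer c m"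
    using assms(1) by (auto simp: pochhammer_pos)
  have "pochhammer c j * pochhammer c m * (c + real j) \<le> pochhammer c j * pochhammer c m * (c + real m)"
    using pos m by (intro mult_left_mono) auto
  then have "F c j \<le> F c (Suc j)"
    unfolding F_def m using pos assms
    by (intro divide_left_mono) (auto simp: pochhammer_Suc mult_ac)
  then show ?case
    using step by simp
qed simp

text \<open>Both sequences are invariant under j -> N - j, so all indices can be folded into the
  lower half, where both increase.\<close>

private lemma s_F_comonotone:
  assumes "0 < c" "i \<le> N" "j \<le> N"
  shows "0 \<le> (s i - s j) * (F c i - F c j)"
proof -
  define m where "m i = min i (N - i)" for i
  have m: "2 * m i \<le> N" for i
    by (auto simp: m_def min_def)
  have red: "s (m i) = s i" "F c (m i) = F c i" if "i \<le> N" for i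
    using that by (auto simp: m_def min_def s_def F_def algebra_simps)
  have "0 \<le> (s (m i) - s (m j)) * (F c (m i) - F c (m j))"
  proof (cases "m i \<le> m j")
    case True
    then show ?thesis
      using s_mono[of "m i" "m j"] F_mono[of c "m i" "m j"] m assms
      by (intro mult_nonpos_nonpos) auto
  next
    case False
    then show ?thesis
      using s_mono[of "m j" "m i"] F_mono[of c "m j" "m i"] m assms
      by (intro mult_nonneg_nonneg) auto
  qed
  then show ?thesis
    using red assms by simp
qed

lemma kummer_cross_coeff_nonneg:
  assumes "0 < c"
  shows "0 \<le> (\<Sum>j\<le>N. kummer_coeff a c j * kummer_coeff a c (N - j) *
      (real N / a - (real (N - j) - real j) * (H (N - j) - H j)))"
proof -
  have "0 \<le> (\<Sum>j\<le>N. V j) * (\<Sum>j\<le>N. V j * s j * F c j)"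
    using chebyshev_sum_weighted[of "{..N}" V s "F c"] V_nonneg s_F_comonotone[OF assms]
    by (simp add: sum_V_s)
  moreover have "0 < (\<Sum>j\<le>N. V j)"
    using a by (intro sum_pos) (auto simp: V_def pochhammer_pos)
  ultimately have "0 \<le> (\<Sum>j\<le>N. V j * s j * F c j)"
    by (simp add: zero_le_mult_iff)
  also have "\<dots> = (\<Sum>j\<le>N. kummer_coeff a c j * kummer_coeff a c (N - j) * s j)"
    by (intro sum.cong) (auto simp: V_def F_def kummer_coeff_def)
  finally show ?thesis
    by (simp add: s_def)
qed

lemma kummer_cross_coeff_symmetrise:
  "2 * (\<Sum>j\<le>N. kummer_coeff a c j * (real (N - j) * kummer_coeff a c (N - j)) *
      (H j - H (N - j) + 1 / a)) =
   (\<Sum>j\<le>N. kummer_coeff a c j * kummer_coeff a c (N - j) *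
      (real N / a - (real (N - j) - real j) * (H (N - j) - H j)))"
proof -
  define f where "f j = kummer_coeff a c j * (real (N - j) * kummer_coeff a c (N - j)) *
      (H j - H (N - j) + 1 / a)" for j
  have "2 * (\<Sum>j\<le>N. f j) = (\<Sum>j\<le>N. f j + f (N - j))"
    by (simp add: sum.distrib sum_atMost_reflect)
  also have "\<dots> = (\<Sum>j\<le>N. kummer_coeff a c j * kummer_coeff a c (N - j) *
      (real N / a - (real (N - j) - real j) * (H (N - j) - H j)))"
  proof (rule sum.cong)
    fix j assume "j \<in> {..N}"
    then have "N - (N - j) = j" "real (N - j) = real N - real j"
      by auto
    then show "f j + f (N - j) = kummer_coeff a c j * kummer_coeff a c (N - j) *
      (real N / a - (real (N - j) - real j) * (H (N - j) - H j))"
      using a by (simp add: f_def field_simps)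
  qed simp
  finally show ?thesis
    by (simp add: f_def)
qed

end

text \<open>By the shift formula both series at (a + 1, c + 1) carry the same factor c / a in front
  of derivative-type coefficients. What remains of the difference is a Cauchy product with
  coefficients \<open>e (Suc n)\<close>, one degree up because of the derivative.\<close>

lemma kummer_ratio_strict_decreasing:
  assumes "0 < a" "0 < c" "0 < x"
  shows "kummer_da (a + 1) (c + 1) x * kummer a c x < kummer_da a c x * kummer (a + 1) (c + 1) x"
proof -
  define w where "w = kummer_coeff a c"
  define H where "H = shifted_harmonic a"
  define e where "e N = (\<Sum>j\<le>N. w j * (real (N - j) * w (N - j)) * (H j - H (N - j) + 1 / a))" for N
  define w' where "w' j = real (Suc j) * w (Suc j)" for j
  have w': "kummer_coeff (a + 1) (c + 1) j = c / a * w' j" for j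
    using kummer_coeff_shift[OF assms(1,2)] by (simp add: w'_def w_def)
  have H': "shifted_harmonic (a + 1) j = H (Suc j) - 1 / a" for j
    using shifted_harmonic_shift[OF assms(1)] by (simp add: H_def)
  have s1: "summable (\<lambda>j. norm (w j * x ^ j))" "summable (\<lambda>j. norm (w j * H j * x ^ j))"
    unfolding w_def H_def using summable_kummer summable_kummer_da assms by auto
  have s2: "summable (\<lambda>j. norm (w' j * x ^ j))"
    "summable (\<lambda>j. norm (w' j * (H (Suc j) - 1 / a) * x ^ j))"
  proof -
    have "summable (\<lambda>j. a / c * norm (kummer_coeff (a + 1) (c + 1) j * x ^ j))"
      "summable (\<lambda>j. a / c * norm (kummer_coeff (a + 1) (c + 1) j * shifted_harmonic (a + 1) j * x ^ j))"
      using summable_kummer[of "a + 1" "c + 1" x] summable_kummer_da[of "a + 1" "c + 1" x] assms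
      by (auto intro!: summable_mult)
    moreover have "a / c * norm (kummer_coeff (a + 1) (c + 1) j * x ^ j) = norm (w' j * x ^ j)"
      "a / c * norm (kummer_coeff (a + 1) (c + 1) j * shifted_harmonic (a + 1) j * x ^ j) =
        norm (w' j * (H (Suc j) - 1 / a) * x ^ j)" for j
      using assms by (simp_all add: w' H' abs_mult)
    ultimately show "summable (\<lambda>j. norm (w' j * x ^ j))"
      "summable (\<lambda>j. norm (w' j * (H (Suc j) - 1 / a) * x ^ j))"
      by (simp_all only:)
  qed
  have e0: "e 0 = 0"
    by (simp add: e_def)
  have e_Suc: "(\<Sum>i\<le>n. (w i * H i * x ^ i) * (w' (n - i) * x ^ (n - i))) -
      (\<Sum>i\<le>n. (w i * x ^ i) * (w' (n - i) * (H (Suc (n - i)) - 1 / a) * x ^ (n - i))) = e (Suc n) * x ^ n"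
    for n
  proof -
    have "e (Suc n) * x ^ n = (\<Sum>i\<le>n. w i * (real (Suc n - i) * w (Suc n - i)) *
        (H i - H (Suc n - i) + 1 / a) * x ^ n)"
      by (simp add: e_def sum_distrib_right)
    also have "\<dots> = (\<Sum>i\<le>n. (w i * H i * x ^ i) * (w' (n - i) * x ^ (n - i)) -
      (w i * x ^ i) * (w' (n - i) * (H (Suc (n - i)) - 1 / a) * x ^ (n - i)))"
    proof (rule sum.cong)
      fix i assume "i \<in> {..n}"
      then have i: "Suc n - i = Suc (n - i)" "x ^ n = x ^ i * x ^ (n - i)"
        by (auto simp: power_add[symmetric] Suc_diff_le)
      show "w i * (real (Suc n - i) * w (Suc n - i)) * (H i - H (Suc n - i) + 1 / a) * x ^ n =
        (w i * H i * x ^ i) * (w' (n - i) * x ^ (n - i)) -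
        (w i * x ^ i) * (w' (n - i) * (H (Suc (n - i)) - 1 / a) * x ^ (n - i))"
        unfolding i w'_def by (simp add: algebra_simps)
    qed simp
    finally show ?thesis
      by (simp add: sum_subtractf)
  qed
  have e_sums: "(\<lambda>n. e (Suc n) * x ^ n) sums
      ((\<Sum>j. w j * H j * x ^ j) * (\<Sum>j. w' j * x ^ j) -
       (\<Sum>j. w j * x ^ j) * (\<Sum>j. w' j * (H (Suc j) - 1 / a) * x ^ j))"
    unfolding e_Suc[symmetric] by (intro sums_diff Cauchy_product_sums s1 s2)
  have e_sym: "2 * e N = (\<Sum>j\<le>N. w j * w (N - j) *
      (real N / a - (real (N - j) - real j) * (H (N - j) - H j)))" for N
    unfolding e_def w_def H_def by (rule kummer_cross_coeff_symmetrise[OF assms(1)])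
  have e_nonneg: "0 \<le> e N" for N
    using kummer_cross_coeff_nonneg[OF assms(1,2), of N] e_sym[of N] unfolding w_def H_def by simp
  \<comment> \<open>\<open>e 0\<close> and \<open>e 1\<close> vanish, so degree 2 is the first that
    can give strictness; its value is a / (c^2 (c + 1)). In the shifted series it stands at index
    1.\<close>
  have "0 < e (Suc 1)"
  proof -
    have vals: "w 0 = 1" "w 1 = a / c" "w (Suc 1) = a * (a + 1) / (2 * (c * (c + 1)))"
      "H 0 = 0" "H 1 = 1 / a" "H (Suc 1) = 1 / a + 1 / (a + 1)"
      by (simp_all add: w_def H_def kummer_coeff_def pochhammer_Suc shifted_harmonic_Suc)
    have "2 * e (Suc 1) = w 0 * w (Suc 1) * (2 / a - 2 * (H (Suc 1) - H 0)) +
        w 1 * w 1 * (2 / a) + w (Suc 1) * w 0 * (2 / a - (0 - 2) * (H 0 - H (Suc 1)))"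
      by (simp add: e_sym)
    also have "\<dots> = 2 * (a / c\<^sup>2 - a / (c * (c + 1)))"
      unfolding vals using assms by (simp add: divide_simps power2_eq_square)
    finally have "e (Suc 1) = a / c\<^sup>2 - a / (c * (c + 1))"
      by simp
    also have "\<dots> = a / (c\<^sup>2 * (c + 1))"
      using assms by (simp add: divide_simps power2_eq_square) (simp add: algebra_simps)
    finally show ?thesis
      using assms by simp
  qed
  then have "0 < e (Suc 1) * x ^ 1"
    using assms by simp
  then have pos: "0 < (\<Sum>n. e (Suc n) * x ^ n)"
    using e_nonneg assms by (intro suminf_pos2[of _ 1] sums_summable[OF e_sums]) auto
  have k1: "kummer (a + 1) (c + 1) x = c / a * (\<Sum>j. w' j * x ^ j)"
    using suminf_mult[OF summable_norm_cancel[OF s2(1)], of "c / a"]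
    by (simp only: kummer_eq w' mult.assoc)
  have k2: "kummer_da (a + 1) (c + 1) x = c / a * (\<Sum>j. w' j * (H (Suc j) - 1 / a) * x ^ j)"
    using suminf_mult[OF summable_norm_cancel[OF s2(2)], of "c / a"]
      kummer_da_eq[of "a + 1" "c + 1" x] assms
    by (simp add: w' H' mult.assoc del: times_divide_eq_left)
  have k3: "kummer a c x = (\<Sum>j. w j * x ^ j)" "kummer_da a c x = (\<Sum>j. w j * H j * x ^ j)"
    using assms by (simp_all add: kummer_eq kummer_da_eq w_def H_def)
  have "kummer_da a c x * kummer (a + 1) (c + 1) x - kummer_da (a + 1) (c + 1) x * kummer a c x =
      c / a * (\<Sum>n. e (Suc n) * x ^ n)"
    unfolding k1 k2 k3 sums_unique[OF e_sums, symmetric] by (simp only: right_diff_distrib mult_ac)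
  also have "0 < \<dots>"
    using pos assms by simp
  finally show ?thesis
    by simp
qed

lemma kummer_pos:
  assumes "0 < a" "0 < c" "0 \<le> x"
  shows "0 < kummer a c x"
  unfolding kummer_eq
  using assms kummer_coeff_pos[of a c]
  by (intro suminf_pos2[of _ 0] summable_norm_cancel[OF summable_kummer])
    (auto intro!: mult_nonneg_nonneg simp: less_imp_le)

lemma strict_mono_on_kummer_root:
  assumes "0 < \<theta>"
  shows "strict_mono_on {1..} (kummer_root \<theta>)"
proof -
  \<comment> \<open>If the next root were at most r, then at r the left-hand side of the equation
    for k + 1 would be nonnegative and that for k is nonpositive. Multiplying these two inequalities
    contradicts the strict decrease of the ratio.\<close>
  have step: "kummer_root \<theta> k < kummer_root \<theta> (Suc k)" if "1 \<le> k" for k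
  proof (rule ccontr)
    define r where "r = kummer_root \<theta> k"
    define a c where "a = real k" and "c = \<theta> + real k"
    have ac: "0 < a" "0 < c"
      using assms that by (auto simp: a_def c_def)
    have Suc_eq: "real (Suc k) = a + 1" "\<theta> + (a + 1) = c + 1"
      by (simp_all add: a_def c_def)
    have r: "0 < r"
      unfolding r_def using kummer_root_pos[OF assms that] .
    assume "\<not> kummer_root \<theta> k < kummer_root \<theta> (Suc k)"
    then have le: "kummer (a + 1) (c + 1) r \<le> \<theta> * kummer_da (a + 1) (c + 1) r"
      using kummer_root_above[of \<theta> "Suc k" r, unfolded Suc_eq] assms by (simp add: r_def)
    have "\<theta> * kummer_da a c r \<le> kummer a c r"
      using kummer_root_below[OF assms that, of r] r by (simp add: a_def c_def r_def)
    then have "\<theta> * kummer_da a c r * kummer (a + 1) (c + 1) r \<le> kummer a c r * (\<theta> * kummer_da (a + 1) (c + 1) r)"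
      using kummer_pos[OF ac, of r] kummer_pos[of "a + 1" "c + 1" r] le ac r by (intro mult_mono) auto
    moreover have "\<theta> * (kummer_da (a + 1) (c + 1) r * kummer a c r) < \<theta> * (kummer_da a c r * kummer (a + 1) (c + 1) r)"
      using kummer_ratio_strict_decreasing[OF ac r] assms by simp
    ultimately show False
      by (simp add: mult_ac)
  qed
  have "kummer_root \<theta> i < kummer_root \<theta> (Suc (i + d))" if "1 \<le> i" for i d
    by (induction d) (use step that in \<open>auto intro: less_trans\<close>)
  then show ?thesis
    by (intro strict_mono_onI) (auto dest!: less_imp_Suc_add)
qed

section \<open>Counts, arrivals and marks\<close>

lemma measurable_sum_count_space:
  fixes f :: "'i \<Rightarrow> 'b \<Rightarrow> nat"
  assumes "\<And>i. i \<in> I \<Longrightarrow> f i \<in> measurable N (count_space UNIV)"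
  shows "(\<lambda>x. \<Sum>i\<in>I. f i x) \<in> measurable N (count_space UNIV)"
  using assms
proof (induction I rule: infinite_finite_induct)
  case (insert i I)
  have "(\<lambda>x. f i x + (\<Sum>i\<in>I. f i x)) \<in> measurable N (count_space UNIV)"
  proof (rule measurable_compose_countable[where f = "\<lambda>m x. m + (\<Sum>i\<in>I. f i x)" and g = "f i"])
    show "(\<lambda>x. m + (\<Sum>i\<in>I. f i x)) \<in> measurable N (count_space UNIV)" for m
      by (rule measurable_compose[where g = "\<lambda>y. m + y" and N = "count_space UNIV"])
        (use insert in auto)
  qed (use insert in auto)
  then show ?case
    using insert by simp
qed auto

lemma sets_Collect_count_space:
  assumes "f \<in> measurable N (count_space UNIV)"
  shows "{x \<in> space N. P (f x)} \<in> sets N"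
  using measurable_sets[OF assms, of "{n. P n}"] by (simp add: vimage_def Int_def conj_commute)

section \<open>Independence of generated \<sigma>-algebras\<close>

context prob_space
begin

text \<open>Dynkin's \<pi>-\<lambda> argument against one fixed event, with {Z} as the second
  generator.\<close>

lemma prob_Int_sigma_sets:
  assumes "Int_stable G" "G \<subseteq> events" "Z \<in> events"
    and indep: "\<And>A. A \<in> G \<Longrightarrow> prob (A \<inter> Z) = prob A * prob Z"
    and A: "A \<in> sigma_sets (space M) G"
  shows "prob (A \<inter> Z) = prob A * prob Z"
proof -
  have "indep_set (sigma_sets (space M) G) (sigma_sets (space M) {Z})"
    using assms by (intro indep_set_sigma_sets indep_setI) (auto simp: Int_stable_def)
  then show ?thesis
    using A by (rule indep_setD) auto
qed

text \<open>Disjoint blocks of an independent family generate independent \<sigma>-algebras. The two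
  blocks are indexed by \<open>bool\<close> to fit the grouping theorem for families.\<close>

lemma prob_Int_indep_vars:
  assumes indep: "indep_vars (\<lambda>_. count_space UNIV) Y K"
    and "I \<subseteq> K" "J \<subseteq> K" "I \<inter> J = {}"
    and A: "A \<in> sigma_sets (space M) (\<Union>i\<in>I. {Y i -` S \<inter> space M |S. True})"
    and B: "B \<in> sigma_sets (space M) (\<Union>i\<in>J. {Y i -` S \<inter> space M |S. True})"
  shows "prob (A \<inter> B) = prob A * prob B"
proof -
  define G where "G i = {Y i -` S \<inter> space M |S. True}" for i
  have "indep_sets G K"
    using indep unfolding indep_vars_def2 G_def by simp
  then have "indep_sets G (\<Union>b\<in>UNIV. case_bool I J b)"
    by (rule indep_sets_mono_index[rotated]) (use assms in \<open>auto simp: UNIV_bool\<close>)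
  moreover have "Int_stable (G i)" for i
  proof (rule Int_stableI)
    fix a b assume "a \<in> G i" "b \<in> G i"
    then obtain S S' where "a = Y i -` S \<inter> space M" "b = Y i -` S' \<inter> space M"
      by (auto simp: G_def)
    then have "a \<inter> b = Y i -` (S \<inter> S') \<inter> space M"
      by auto
    then show "a \<inter> b \<in> G i"
      unfolding G_def by blast
  qed
  moreover have "disjoint_family_on (case_bool I J) UNIV"
    using assms by (auto simp: disjoint_family_on_def split: bool.split)
  ultimately have "indep_sets (\<lambda>b. sigma_sets (space M) (\<Union>i\<in>case_bool I J b. G i)) UNIV"
    by (intro indep_sets_collect_sigma)
  from indep_setsD[OF this, of UNIV "case_bool A B"] show ?thesis
    using A B by (simp add: UNIV_bool G_def ac_simps)
qed

end

context poisson_arrivals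
begin

abbreviation arrivals :: "real \<Rightarrow> 'a \<Rightarrow> nat" where "arrivals \<equiv> arrival_count T"

lemma epoch_less: "\<omega> \<in> space M \<Longrightarrow> 1 \<le> i \<Longrightarrow> i < j \<Longrightarrow> T i \<omega> < T j \<omega>"
  using strict_mono_onD[OF epochs_increasing[of \<omega>], of i j] by auto

lemma epoch_mono: "\<omega> \<in> space M \<Longrightarrow> 1 \<le> i \<Longrightarrow> i \<le> j \<Longrightarrow> T i \<omega> \<le> T j \<omega>"
  using epoch_less[of \<omega> i j] by (cases "i = j") auto

lemma epoch_gt_0: "\<omega> \<in> space M \<Longrightarrow> 1 \<le> i \<Longrightarrow> 0 < T i \<omega>"
  using epoch_mono[of \<omega> 1 i] epoch_pos[of \<omega>] by auto

text \<open>Increasing epochs make the indices of the arrivals up to \<open>t\<close> an initial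
  segment, so statements about counts and about epochs are interchangeable. Beyond time 1 this set
  may be infinite, and \<open>card\<close> would then return 0.\<close>

lemma arrivals_upto:
  assumes \<omega>: "\<omega> \<in> space M" and "t \<le> 1"
  shows "{k. 1 \<le> k \<and> T k \<omega> \<le> t} = {1..arrivals t \<omega>}"
proof -
  define S where "S = {k. 1 \<le> k \<and> T k \<omega> \<le> t}"
  have fin: "finite S"
    unfolding S_def by (rule finite_subset[OF _ finitely_many_arrivals[OF \<omega>]]) (use assms in auto)
  have "\<exists>n. S = {1..n}"
  proof (cases "S = {}")
    case False
    have "{1..Max S} \<subseteq> S"
    proof
      fix i assume i: "i \<in> {1..Max S}"
      have "Max S \<in> S"
        using fin False by simp
      then show "i \<in> S"
        using i epoch_mono[OF \<omega>, of i "Max S"] by (auto simp: S_def)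
    qed
    moreover have "S \<subseteq> {1..Max S}"
      using fin by (auto simp: S_def)
    ultimately show ?thesis
      by blast
  qed (auto intro: exI[of _ 0])
  then obtain n where "S = {1..n}" by blast
  then show ?thesis
    by (simp add: arrival_count_def S_def)
qed

lemma epoch_le_iff:
  "\<omega> \<in> space M \<Longrightarrow> 1 \<le> k \<Longrightarrow> t \<le> 1 \<Longrightarrow> T k \<omega> \<le> t \<longleftrightarrow> k \<le> arrivals t \<omega>"
  using arrivals_upto[of \<omega> t] by (auto simp: set_eq_iff)

lemma arrivals_eq_0: "\<omega> \<in> space M \<Longrightarrow> arrivals 0 \<omega> = 0"
  using arrivals_upto[of \<omega> 0] epoch_gt_0[of \<omega>] by (force simp: arrival_count_def)

lemma arrivals_mono: "\<omega> \<in> space M \<Longrightarrow> s \<le> t \<Longrightarrow> t \<le> 1 \<Longrightarrow> arrivals s \<omega> \<le> arrivals t \<omega>"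
  unfolding arrival_count_def
  by (intro card_mono finite_subset[OF _ finitely_many_arrivals[of \<omega>]]) auto

section \<open>The arrival history and the increments after it\<close>

definition arrival_history :: "real \<Rightarrow> 'a measure" where
  "arrival_history t = sigma (space M) (arrival_events M T t)"

lemma space_arrival_history [simp]: "space (arrival_history t) = space M"
  and sets_arrival_history: "sets (arrival_history t) = sigma_sets (space M) (arrival_events M T t)"
proof -
  have "arrival_events M T t \<subseteq> Pow (space M)"
    by (auto simp: arrival_events_def)
  then show "space (arrival_history t) = space M"
    "sets (arrival_history t) = sigma_sets (space M) (arrival_events M T t)"
    by (simp_all add: arrival_history_def space_measure_of sets_measure_of)
qed

lemma epoch_event: "1 \<le> k \<Longrightarrow> {\<omega> \<in> space M. T k \<omega> \<le> s} \<in> events"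
  using epoch_measurable[of k] by simp

lemma sets_arrival_history_subset: "sets (arrival_history t) \<subseteq> events"
  unfolding sets_arrival_history
  by (intro sets.sigma_sets_subset) (auto simp: arrival_events_def epoch_event)

lemma sets_arrival_history_mono: "s \<le> t \<Longrightarrow> sets (arrival_history s) \<subseteq> sets (arrival_history t)"
  unfolding sets_arrival_history
  by (intro sigma_sets_mono') (fastforce simp: arrival_events_def)

lemma arrivals_measurable_history:
  assumes "0 \<le> s" "s \<le> t" "t \<le> 1"
  shows "arrivals s \<in> measurable (arrival_history t) (count_space UNIV)"
proof -
  have gen: "{\<omega> \<in> space M. T k \<omega> \<le> s} \<in> sets (arrival_history t)" if "1 \<le> k" for k
    unfolding sets_arrival_history arrival_events_def using that assms by blast
  have ge: "{\<omega> \<in> space M. k \<le> arrivals s \<omega>} \<in> sets (arrival_history t)" for k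
  proof (cases "k = 0")
    case True
    then show ?thesis
      using sets.top[of "arrival_history t"] by simp
  next
    case False
    then have "{\<omega> \<in> space M. k \<le> arrivals s \<omega>} = {\<omega> \<in> space M. T k \<omega> \<le> s}"
      using assms epoch_le_iff[of _ k s] by auto
    with False gen show ?thesis
      by simp
  qed
  have "arrivals s -` {k} \<inter> space (arrival_history t) \<in> sets (arrival_history t)" for k
  proof -
    have "arrivals s -` {k} \<inter> space (arrival_history t) =
        {\<omega> \<in> space M. k \<le> arrivals s \<omega>} - {\<omega> \<in> space M. Suc k \<le> arrivals s \<omega>}"
      by auto
    then show ?thesis
      using ge by auto
  qed
  then show ?thesis
    by (simp add: measurable_count_space_eq2_countable)
qed

lemma arrivals_measurable:
  "0 \<le> s \<Longrightarrow> s \<le> 1 \<Longrightarrow> arrivals s \<in> measurable M (count_space UNIV)"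
  using arrivals_measurable_history[of s 1] sets_arrival_history_subset[of 1]
  by (auto simp: measurable_def)

lemma arrivals_diff_measurable_history:
  assumes "0 \<le> s" "s \<le> u" "u \<le> t" "t \<le> 1"
  shows "(\<lambda>\<omega>. arrivals u \<omega> - arrivals s \<omega>) \<in> measurable (arrival_history t) (count_space UNIV)"
proof (rule measurable_compose_countable[where g = "arrivals u"])
  show "(\<lambda>\<omega>. m - arrivals s \<omega>) \<in> measurable (arrival_history t) (count_space UNIV)" for m
    by (rule measurable_compose[OF arrivals_measurable_history]) (use assms in auto)
qed (use assms in \<open>auto intro: arrivals_measurable_history\<close>)

lemma prob_increment:
  assumes "0 \<le> s" "s < t" "t \<le> 1"
  shows "prob {\<omega> \<in> space M. arrivals t \<omega> - arrivals s \<omega> = n} =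
    exp (- (rate * (t - s))) * ((rate * (t - s)) ^ n / fact n)"
proof -
  have "(\<lambda>\<omega>. arrivals t \<omega> - arrivals s \<omega>) \<in> measurable M (count_space UNIV)"
    using arrivals_diff_measurable_history[of s t t] sets_arrival_history_subset[of t] assms
    by (auto simp: measurable_def)
  then have "prob ((\<lambda>\<omega>. arrivals t \<omega> - arrivals s \<omega>) -` {n} \<inter> space M) =
      measure (distr M (count_space UNIV) (\<lambda>\<omega>. arrivals t \<omega> - arrivals s \<omega>)) {n}"
    by (simp add: measure_distr)
  also have "\<dots> = pmf (poisson_pmf (rate * (t - s))) n"
    unfolding poisson_increments[OF assms] by (simp add: measure_pmf_single)
  finally show ?thesis
    using assms rate_pos by (simp add: vimage_def Int_def conj_commute)
qed

text \<open>An epoch equal to 1 forces an arrival in (s, 1] for every s < 1, and the probability of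
  that tends to 0 as s tends to 1. This null event is discarded because a win requires stopping
  strictly before 1, while the threshold rule and the later successes include time 1.\<close>

lemma AE_epoch_neq_1: "AE \<omega> in M. \<forall>k\<ge>1. T k \<omega> \<noteq> 1"
proof -
  have "AE \<omega> in M. T k \<omega> \<noteq> 1" if k: "1 \<le> k" for k
  proof -
    define E where "E = {\<omega> \<in> space M. T k \<omega> = 1}"
    have E: "E \<in> events"
      unfolding E_def using epoch_measurable[OF k] by simp
    have bound: "prob E \<le> 1 - exp (- (rate * (1 - s)))" if s: "0 \<le> s" "s < 1" for s
    proof -
      define Z where "Z = {\<omega> \<in> space M. arrivals 1 \<omega> - arrivals s \<omega> = 0}"
      have Z: "Z \<in> events"
        unfolding Z_def
        using sets_Collect_count_space[OF arrivals_diff_measurable_history[of s 1 1], where P = "\<lambda>n. n = 0"]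
          sets_arrival_history_subset[of 1] s by auto
      have "E \<subseteq> space M - Z"
      proof
        fix \<omega> assume "\<omega> \<in> E"
        then have "\<omega> \<in> space M" "k \<le> arrivals 1 \<omega>" "\<not> k \<le> arrivals s \<omega>"
          using s k epoch_le_iff[of \<omega> k 1] epoch_le_iff[of \<omega> k s] by (auto simp: E_def)
        then show "\<omega> \<in> space M - Z"
          by (simp add: Z_def)
      qed
      then have "prob E \<le> prob (space M - Z)"
        using Z by (intro finite_measure_mono) auto
      also have "\<dots> = 1 - exp (- (rate * (1 - s)))"
        using prob_compl[OF Z] prob_increment[of s 1 0] s by (simp add: Z_def)
      finally show ?thesis .
    qed
    have "((\<lambda>s. 1 - exp (- (rate * (1 - s)))) \<longlongrightarrow> 1 - exp (- (rate * (1 - 1)))) (at_left 1)"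
      by (intro tendsto_intros)
    moreover have "\<forall>\<^sub>F s in at_left 1. prob E \<le> 1 - exp (- (rate * (1 - s)))"
      using bound by (subst eventually_at_left[of 0]) (auto intro!: exI[of _ 0])
    ultimately have "prob E \<le> 1 - exp (- (rate * (1 - 1)))"
      by (rule tendsto_lowerbound) simp
    then have "prob E = 0"
      using measure_nonneg[of M E] by simp
    then have "AE \<omega> in M. \<omega> \<notin> E"
      using prob_eq_0 E by simp
    then show ?thesis
      by (rule AE_mp) (auto intro!: AE_I2 simp: E_def)
  qed
  then show ?thesis
    by (subst AE_all_countable) (auto simp: AE_all_countable)
qed

text \<open>On a common grid the counts at the times in \<open>S\<close> are partial sums of the
  first cell increments, and the increment after \<open>u\<close> belongs to the last cell.\<close>

lemma prob_finite_history_increment: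
  assumes u: "0 \<le> u" "u < 1" and S: "finite S" "S \<subseteq> {0..u}"
  shows "prob ({\<omega> \<in> space M. \<forall>s\<in>S. Q s (arrivals s \<omega>)} \<inter>
      {\<omega> \<in> space M. arrivals 1 \<omega> - arrivals u \<omega> = n}) =
    prob {\<omega> \<in> space M. \<forall>s\<in>S. Q s (arrivals s \<omega>)} *
    prob {\<omega> \<in> space M. arrivals 1 \<omega> - arrivals u \<omega> = n}"
proof -
  \<comment> \<open>The point 0 lets the partial sums start from the count 0; the point
    \<open>u\<close> makes the last cell, closed by \<open>v (Suc m) = 1\<close>, exactly the time
    after \<open>u\<close>.\<close>
  define S' where "S' = insert 0 (insert u S)"
  define ys where "ys = sorted_list_of_set S'"
  define m where "m = length ys - 1"
  define v where "v i = (if i \<le> m then ys ! i else 1)" for i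
  have fin: "finite S'"
    using S by (simp add: S'_def)
  have set: "set ys = S'"
    using fin by (simp add: ys_def)
  then have len: "length ys = Suc m"
    by (cases ys) (auto simp: m_def S'_def)
  have ys_less: "ys ! i < ys ! j" if "i < j" "j \<le> m" for i j
    using that len strict_sorted_list_of_set[of S']
    by (auto simp: ys_def sorted_wrt_iff_nth_less)
  have ys_le: "ys ! i \<le> ys ! j" if "i \<le> j" "j \<le> m" for i j
    using ys_less[of i j] that by (cases "i = j") auto
  have ys_in: "ys ! i \<in> S'" if "i \<le> m" for i
    using that len set nth_mem[of i ys] by auto
  then have ys_u: "0 \<le> ys ! i" "ys ! i \<le> u" if "i \<le> m" for i
    using that S u by (fastforce simp: S'_def)+
  have nth_ex: "\<exists>i\<le>m. ys ! i = s" if "s \<in> S'" for s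
    using that len unfolding set[symmetric] by (auto simp: in_set_conv_nth less_Suc_eq_le)
  obtain i where "i \<le> m" "ys ! i = 0"
    using nth_ex[of 0] by (auto simp: S'_def)
  then have v0: "v 0 = 0"
    using ys_le[of 0 i] ys_u[of 0] by (simp add: v_def)
  obtain i where "i \<le> m" "ys ! i = u"
    using nth_ex[of u] by (auto simp: S'_def)
  then have vm: "v m = u"
    using ys_le[of i m] ys_u[of m] by (simp add: v_def)
  have v_Suc: "v (Suc m) = 1"
    by (simp add: v_def)
  have v_mono: "strict_mono_on {..Suc m} v"
  proof (rule strict_mono_onI)
    fix i j assume "i \<in> {..Suc m}" "j \<in> {..Suc m}" "i < j"
    then show "v i < v j"
      using ys_less[of i j] ys_u[of i] u by (auto simp: v_def)
  qed
  define Y where "Y i \<omega> = arrivals (v (Suc i)) \<omega> - arrivals (v i) \<omega>" for i \<omega>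
  have indep: "indep_vars (\<lambda>_. count_space UNIV) Y {..<Suc m}"
    unfolding Y_def by (rule independent_increments) (use v0 v_Suc v_mono in auto)
  have count: "arrivals (v j) \<omega> = (\<Sum>i<j. Y i \<omega>)" if "\<omega> \<in> space M" "j \<le> m" for j \<omega>
    using that(2)
  proof (induction j)
    case 0
    then show ?case
      using v0 arrivals_eq_0[OF that(1)] by simp
  next
    case (Suc j)
    have "v j \<le> v (Suc j)" "v (Suc j) \<le> 1"
      using Suc.prems ys_le[of j "Suc j"] ys_u[of "Suc j"] u by (auto simp: v_def)
    then have "arrivals (v j) \<omega> \<le> arrivals (v (Suc j)) \<omega>"
      using arrivals_mono[OF that(1)] by blast
    then show ?case
      using Suc by (simp add: Y_def)
  qed
  define A where "A = {\<omega> \<in> space M. \<forall>s\<in>S. Q s (arrivals s \<omega>)}"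
  define P where "P = sigma (space M) (\<Union>i\<in>{..<m}. {Y i -` S \<inter> space M |S. True})"
  have P: "space P = space M"
    "sets P = sigma_sets (space M) (\<Union>i\<in>{..<m}. {Y i -` S \<inter> space M |S. True})"
    unfolding P_def by (auto intro!: space_measure_of sets_measure_of)
  have Y_P: "Y i \<in> measurable P (count_space UNIV)" if "i < m" for i
    by (rule measurableI) (use that in \<open>auto simp: P\<close>)
  have "A = {\<omega> \<in> space P. \<forall>j\<in>{j. j \<le> m \<and> v j \<in> S}. Q (v j) (\<Sum>i<j. Y i \<omega>)}"
  proof -
    have ex: "\<exists>j\<le>m. v j = s" if "s \<in> S" for s
      using nth_ex[of s] that by (auto simp: S'_def v_def)
    have "(\<forall>s\<in>S. Q s (arrivals s \<omega>)) \<longleftrightarrow>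
        (\<forall>j\<in>{j. j \<le> m \<and> v j \<in> S}. Q (v j) (arrivals (v j) \<omega>))" for \<omega>
      using ex by blast
    then show ?thesis
      unfolding A_def P by (intro Collect_cong conj_cong refl) (simp add: count)
  qed
  also have "\<dots> \<in> sets P"
  proof (rule sets.sets_Collect_finite_All)
    show "{\<omega> \<in> space P. Q (v j) (\<Sum>i<j. Y i \<omega>)} \<in> sets P" if "j \<in> {j. j \<le> m \<and> v j \<in> S}" for j
      by (rule sets_Collect_count_space[OF measurable_sum_count_space]) (use that Y_P in auto)
    show "finite {j. j \<le> m \<and> v j \<in> S}"
      by simp
  qed
  finally have "A \<in> sigma_sets (space M) (\<Union>i\<in>{..<m}. {Y i -` S \<inter> space M |S. True})"
    by (simp add: P)
  moreover have "{\<omega> \<in> space M. arrivals 1 \<omega> - arrivals u \<omega> = n} \<in>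
      sigma_sets (space M) (\<Union>i\<in>{m}. {Y i -` S \<inter> space M |S. True})"
  proof (rule sigma_sets.Basic)
    have "{\<omega> \<in> space M. arrivals 1 \<omega> - arrivals u \<omega> = n} = Y m -` {n} \<inter> space M"
      by (auto simp: Y_def vm v_Suc)
    then show "{\<omega> \<in> space M. arrivals 1 \<omega> - arrivals u \<omega> = n} \<in>
        (\<Union>i\<in>{m}. {Y i -` S \<inter> space M |S. True})"
      by auto
  qed
  ultimately show ?thesis
    unfolding A_def[symmetric] by (intro prob_Int_indep_vars[OF indep, of "{..<m}" "{m}"]) auto
qed

lemma prob_history_increment:
  assumes u: "0 \<le> u" "u < 1" and E: "E \<in> sets (arrival_history u)"
  shows "prob (E \<inter> {\<omega> \<in> space M. arrivals 1 \<omega> - arrivals u \<omega> = n}) =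
    prob E * prob {\<omega> \<in> space M. arrivals 1 \<omega> - arrivals u \<omega> = n}"
proof -
  \<comment> \<open>Allowing arbitrary predicates \<open>Q\<close> makes the class stable under
    intersection: over the union of two time sets the predicates are conjoined.\<close>
  define G where "G = {{\<omega> \<in> space M. \<forall>s\<in>S. Q s (arrivals s \<omega>)} |S Q. finite S \<and> S \<subseteq> {0..u}}"
  show ?thesis
  proof (rule prob_Int_sigma_sets[of G])
    show "Int_stable G"
    proof (rule Int_stableI)
      fix a b assume "a \<in> G" "b \<in> G"
      then obtain S Q S' Q' where
        "a = {\<omega> \<in> space M. \<forall>s\<in>S. Q s (arrivals s \<omega>)}" "finite S" "S \<subseteq> {0..u}"
        "b = {\<omega> \<in> space M. \<forall>s\<in>S'. Q' s (arrivals s \<omega>)}" "finite S'" "S' \<subseteq> {0..u}"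
        unfolding G_def by blast
      moreover from this have "a \<inter> b = {\<omega> \<in> space M. \<forall>s\<in>S \<union> S'.
          (s \<in> S \<longrightarrow> Q s (arrivals s \<omega>)) \<and> (s \<in> S' \<longrightarrow> Q' s (arrivals s \<omega>))}"
        by blast
      ultimately show "a \<inter> b \<in> G"
        unfolding G_def
        by (intro CollectI exI[of _ "S \<union> S'"]
            exI[of _ "\<lambda>s x. (s \<in> S \<longrightarrow> Q s x) \<and> (s \<in> S' \<longrightarrow> Q' s x)"]) blast
    qed
    show "G \<subseteq> events"
    proof
      fix a assume "a \<in> G"
      then obtain S Q where a: "a = {\<omega> \<in> space M. \<forall>s\<in>S. Q s (arrivals s \<omega>)}"
        and S: "finite S" "S \<subseteq> {0..u}"
        unfolding G_def by blast
      show "a \<in> events"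
        unfolding a using S u
        by (intro sets.sets_Collect_finite_All sets_Collect_count_space arrivals_measurable) auto
    qed
    show "{\<omega> \<in> space M. arrivals 1 \<omega> - arrivals u \<omega> = n} \<in> events"
      using sets_Collect_count_space[OF arrivals_diff_measurable_history[of u 1 1],
          where P = "\<lambda>k. k = n"] sets_arrival_history_subset[of 1] u by auto
    show "prob (A \<inter> {\<omega> \<in> space M. arrivals 1 \<omega> - arrivals u \<omega> = n}) =
      prob A * prob {\<omega> \<in> space M. arrivals 1 \<omega> - arrivals u \<omega> = n}" if "A \<in> G" for A
      using that prob_finite_history_increment[OF u] unfolding G_def by blast
    have "arrival_events M T u \<subseteq> G"
    proof
      fix A assume "A \<in> arrival_events M T u"
      then obtain k s where A: "A = {\<omega> \<in> space M. T k \<omega> \<le> s}" "1 \<le> k" "0 \<le> s" "s \<le> u"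
        by (auto simp: arrival_events_def)
      then have "A = {\<omega> \<in> space M. \<forall>s\<in>{s}. k \<le> arrivals s \<omega>}"
        using u epoch_le_iff[of _ k s] by auto
      then show "A \<in> G"
        unfolding G_def using A by (intro CollectI exI[of _ "{s}"] exI[of _ "\<lambda>_ n. k \<le> n"]) auto
    qed
    then show "E \<in> sigma_sets (space M) G"
      using E sigma_sets_mono'[of "arrival_events M T u" G "space M"]
      by (auto simp: sets_arrival_history)
  qed
qed

end

section \<open>The Markov property at a fixed time\<close>

context last_success_problem
begin

section \<open>Marks and the number of successes among consecutive marks\<close>

definition mark_events :: "nat set \<Rightarrow> 'a measure" where
  "mark_events I = sigma (space M) (\<Union>i\<in>I. {X i -` S \<inter> space M |S. True})"

lemma space_mark_events [simp]: "space (mark_events I) = space M"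
  and sets_mark_events:
    "sets (mark_events I) = sigma_sets (space M) (\<Union>i\<in>I. {X i -` S \<inter> space M |S. True})"
  unfolding mark_events_def by (auto intro!: space_measure_of sets_measure_of)

lemma mark_measurable: "1 \<le> k \<Longrightarrow> X k \<in> measurable M (count_space UNIV)"
  using marks_independent by (auto simp: indep_vars_def)

lemma mark_event: "1 \<le> k \<Longrightarrow> {\<omega> \<in> space M. X k \<omega>} \<in> events"
  using measurable_sets[OF mark_measurable, of k "{True}"]
  by (simp add: vimage_def Int_def conj_commute)

lemma sets_mark_events_subset:
  "I \<subseteq> {1..} \<Longrightarrow> sets (mark_events I) \<subseteq> events"
  unfolding sets_mark_events
  by (intro sets.sigma_sets_subset) (auto intro!: measurable_sets[OF mark_measurable])

lemma sets_mark_events_mono: "I \<subseteq> J \<Longrightarrow> sets (mark_events I) \<subseteq> sets (mark_events J)"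
  unfolding sets_mark_events by (intro sigma_sets_mono') blast

lemma mark_event_in: "k \<in> I \<Longrightarrow> {\<omega> \<in> space M. X k \<omega>} \<in> sets (mark_events I)"
proof -
  assume k: "k \<in> I"
  have "{\<omega> \<in> space M. X k \<omega>} = X k -` {True} \<inter> space M"
    by auto
  then show ?thesis
    unfolding sets_mark_events using k by (intro sigma_sets.Basic) blast
qed

text \<open>With a deterministic number \<open>n\<close> the event depends on the marks alone. Later
  it is intersected with the event that exactly \<open>n\<close> arrivals follow a given
  time.\<close>

definition mark_count_event :: "nat \<Rightarrow> nat \<Rightarrow> nat \<Rightarrow> 'a set" where
  "mark_count_event k n r = {\<omega> \<in> space M. card {j \<in> {k<..k + n}. X j \<omega>} = r}"

lemma mark_count_event_in: "mark_count_event k n r \<in> sets (mark_events {k<..k + n})"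
proof -
  define P where "P = mark_events {k<..k + n}"
  have X: "(\<lambda>\<omega>. of_bool (X j \<omega>) :: nat) \<in> measurable P (count_space UNIV)" if "j \<in> {k<..k + n}" for j
  proof (rule measurable_compose[where g = of_bool and N = "count_space UNIV"])
    show "X j \<in> measurable P (count_space UNIV)"
    proof (rule measurableI)
      show "X j -` S \<inter> space P \<in> sets P" for S
        unfolding P_def sets_mark_events space_mark_events
        by (rule sigma_sets.Basic) (use that in blast)
    qed simp
  qed simp
  have "card {j \<in> {k<..k + n}. X j \<omega>} = (\<Sum>j\<in>{k<..k + n}. of_bool (X j \<omega>))" for \<omega>
    by (simp add: Int_def)
  then have "mark_count_event k n r = {\<omega> \<in> space P. (\<Sum>j\<in>{k<..k + n}. of_bool (X j \<omega>)) = r}"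
    by (simp add: mark_count_event_def P_def)
  also have "\<dots> \<in> sets P"
    by (rule sets_Collect_count_space[OF measurable_sum_count_space]) (rule X)
  finally show ?thesis
    by (simp add: P_def)
qed

lemma marks_after_subset: "{k<..k + n} \<subseteq> {1::nat..}"
  by auto

lemma mark_count_event_events: "mark_count_event k n r \<in> events"
  using mark_count_event_in sets_mark_events_subset[OF marks_after_subset] by blast

lemma prob_Int_mark_events:
  assumes "I \<subseteq> {1..}" "J \<subseteq> {1..}" "I \<inter> J = {}"
    and "A \<in> sets (mark_events I)" "B \<in> sets (mark_events J)"
  shows "prob (A \<inter> B) = prob A * prob B"
  using assms unfolding sets_mark_events
  by (intro prob_Int_indep_vars[OF marks_independent, of I J]) auto

lemma prob_mark:
  assumes "1 \<le> k"
  shows "prob {\<omega> \<in> space M. X k \<omega>} = \<theta> / (\<theta> + real k - 1)"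
    and "prob {\<omega> \<in> space M. \<not> X k \<omega>} = 1 - \<theta> / (\<theta> + real k - 1)"
proof -
  have "0 \<le> \<theta> / (\<theta> + real k - 1)" "\<theta> / (\<theta> + real k - 1) \<le> 1"
    using assms theta_pos by (auto simp: divide_simps)
  then have "pmf (bernoulli_pmf (\<theta> / (\<theta> + real k - 1))) True = \<theta> / (\<theta> + real k - 1)"
    by simp
  moreover have "prob (X k -` {True} \<inter> space M) = measure (distr M (count_space UNIV) (X k)) {True}"
    using mark_measurable[OF assms] by (simp add: measure_distr)
  moreover have "X k -` {True} \<inter> space M = {\<omega> \<in> space M. X k \<omega>}"
    by auto
  ultimately show 1: "prob {\<omega> \<in> space M. X k \<omega>} = \<theta> / (\<theta> + real k - 1)"
    unfolding mark_distribution[OF assms] by (simp add: measure_pmf_single)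
  have "space M - {\<omega> \<in> space M. X k \<omega>} = {\<omega> \<in> space M. \<not> X k \<omega>}"
    by auto
  then show "prob {\<omega> \<in> space M. \<not> X k \<omega>} = 1 - \<theta> / (\<theta> + real k - 1)"
    using prob_compl[OF mark_event[OF assms]] 1 by simp
qed

lemma mark_count_event_Suc:
  "mark_count_event k (Suc n) 0 = mark_count_event k n 0 \<inter> {\<omega> \<in> space M. \<not> X (Suc (k + n)) \<omega>}"
  "mark_count_event k (Suc n) (Suc r) =
     (mark_count_event k n (Suc r) \<inter> {\<omega> \<in> space M. \<not> X (Suc (k + n)) \<omega>}) \<union>
     (mark_count_event k n r \<inter> {\<omega> \<in> space M. X (Suc (k + n)) \<omega>})"
proof -
  have "{j \<in> {k<..k + Suc n}. X j \<omega>} = (if X (Suc (k + n)) \<omega>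
      then insert (Suc (k + n)) {j \<in> {k<..k + n}. X j \<omega>} else {j \<in> {k<..k + n}. X j \<omega>})" for \<omega>
    by (auto simp: le_Suc_eq)
  then have "card {j \<in> {k<..k + Suc n}. X j \<omega>} =
      card {j \<in> {k<..k + n}. X j \<omega>} + (if X (Suc (k + n)) \<omega> then 1 else 0)" for \<omega>
    by simp
  then show
    "mark_count_event k (Suc n) 0 = mark_count_event k n 0 \<inter> {\<omega> \<in> space M. \<not> X (Suc (k + n)) \<omega>}"
    "mark_count_event k (Suc n) (Suc r) =
     (mark_count_event k n (Suc r) \<inter> {\<omega> \<in> space M. \<not> X (Suc (k + n)) \<omega>}) \<union>
     (mark_count_event k n r \<inter> {\<omega> \<in> space M. X (Suc (k + n)) \<omega>})"
    unfolding mark_count_event_def by auto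
qed

lemma prob_mark_count_event_Int:
  shows "prob (mark_count_event k n r \<inter> {\<omega> \<in> space M. X (Suc (k + n)) \<omega>}) =
      prob (mark_count_event k n r) * (\<theta> / (\<theta> + real k + real n))"
    and "prob (mark_count_event k n r \<inter> {\<omega> \<in> space M. \<not> X (Suc (k + n)) \<omega>}) =
      prob (mark_count_event k n r) * (1 - \<theta> / (\<theta> + real k + real n))"
proof -
  have in1: "{\<omega> \<in> space M. X (Suc (k + n)) \<omega>} \<in> sets (mark_events {Suc (k + n)})"
    by (rule mark_event_in) simp
  have "space M - {\<omega> \<in> space M. X (Suc (k + n)) \<omega>} = {\<omega> \<in> space M. \<not> X (Suc (k + n)) \<omega>}"
    by auto
  then have in2: "{\<omega> \<in> space M. \<not> X (Suc (k + n)) \<omega>} \<in> sets (mark_events {Suc (k + n)})"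
    using sets.compl_sets[OF in1] by simp
  have eq: "\<theta> + real (Suc (k + n)) - 1 = \<theta> + real k + real n"
    by simp
  show "prob (mark_count_event k n r \<inter> {\<omega> \<in> space M. X (Suc (k + n)) \<omega>}) =
      prob (mark_count_event k n r) * (\<theta> / (\<theta> + real k + real n))"
    using prob_Int_mark_events[OF marks_after_subset _ _ mark_count_event_in in1, of k n r]
      prob_mark(1)[of "Suc (k + n)"] unfolding eq by simp
  show "prob (mark_count_event k n r \<inter> {\<omega> \<in> space M. \<not> X (Suc (k + n)) \<omega>}) =
      prob (mark_count_event k n r) * (1 - \<theta> / (\<theta> + real k + real n))"
    using prob_Int_mark_events[OF marks_after_subset _ _ mark_count_event_in in2, of k n r]
      prob_mark(2)[of "Suc (k + n)"] unfolding eq by simp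
qed

text \<open>The failure probabilities (k + i) / (\<theta> + k + i) multiply to a ratio of Pochhammer
  symbols, the coefficient of Kummer's function apart from 1 / n!.\<close>

lemma prob_mark_count_event_0:
  assumes "1 \<le> k"
  shows "prob (mark_count_event k n 0) = pochhammer (real k) n / pochhammer (\<theta> + real k) n"
proof (induction n)
  case 0
  then show ?case
    by (simp add: mark_count_event_def prob_space)
next
  case (Suc n)
  have "1 - \<theta> / (\<theta> + real k + real n) = (real k + real n) / (\<theta> + real k + real n)"
    using theta_pos by (simp add: field_simps)
  then show ?case
    using Suc by (simp add: mark_count_event_Suc prob_mark_count_event_Int pochhammer_Suc)
qed

text \<open>Turning one failure into a success multiplies the probability of no success by the odds
  \<theta> / (k + i) of that trial; the odds add up to \<theta> times the shifted harmonic
  sum.\<close>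

lemma prob_mark_count_event_1:
  assumes "1 \<le> k"
  shows "prob (mark_count_event k n 1) =
    pochhammer (real k) n / pochhammer (\<theta> + real k) n * (\<theta> * shifted_harmonic (real k) n)"
proof (induction n)
  case 0
  then show ?case
    by (simp add: mark_count_event_def)
next
  case (Suc n)
  have p: "1 - \<theta> / (\<theta> + real k + real n) = (real k + real n) / (\<theta> + real k + real n)"
    using theta_pos by (simp add: field_simps)
  have disj: "(mark_count_event k n (Suc 0) \<inter> {\<omega> \<in> space M. \<not> X (Suc (k + n)) \<omega>}) \<inter>
      (mark_count_event k n 0 \<inter> {\<omega> \<in> space M. X (Suc (k + n)) \<omega>}) = {}"
    by auto
  have ev: "{\<omega> \<in> space M. X (Suc (k + n)) \<omega>} \<in> events"
    "{\<omega> \<in> space M. \<not> X (Suc (k + n)) \<omega>} \<in> events"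
    using mark_event[of "Suc (k + n)"] by (auto intro: sets.sets_Collect_neg)
  have "prob (mark_count_event k (Suc n) 1) =
      prob (mark_count_event k n 1) * (1 - \<theta> / (\<theta> + real k + real n)) +
      prob (mark_count_event k n 0) * (\<theta> / (\<theta> + real k + real n))"
    unfolding One_nat_def mark_count_event_Suc
    by (subst finite_measure_Union[OF _ _ disj])
      (use ev mark_count_event_events in \<open>auto simp: prob_mark_count_event_Int\<close>)
  also have "\<dots> = pochhammer (real k) n / pochhammer (\<theta> + real k) n *
      ((\<theta> * shifted_harmonic (real k) n) * (real k + real n) + \<theta>) / (\<theta> + real k + real n)"
    unfolding Suc p prob_mark_count_event_0[OF assms]
    by (simp add: add_divide_distrib ring_distribs)
  also have "(\<theta> * shifted_harmonic (real k) n) * (real k + real n) + \<theta> =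
      (real k + real n) * (\<theta> * shifted_harmonic (real k) (Suc n))"
    using assms by (simp add: shifted_harmonic_Suc field_simps)
  finally show ?case
    by (simp add: pochhammer_Suc)
qed

definition later_successes :: "nat \<Rightarrow> 'a \<Rightarrow> nat" where
  "later_successes k \<omega> = card {j. k < j \<and> T j \<omega> \<le> 1 \<and> X j \<omega>}"

text \<open>The conditional probability of exactly \<open>r\<close> successes after time \<open>t\<close>, given that \<open>k\<close> arrivals
  have occurred by then and with \<open>x = (1 - t) * rate\<close>.\<close>

definition later_prob :: "nat \<Rightarrow> nat \<Rightarrow> real \<Rightarrow> real" where
  "later_prob r k x = exp (- x) * (\<Sum>n. prob (mark_count_event k n r) / fact n * x ^ n)"

lemma summable_later_prob: "summable (\<lambda>n. prob (mark_count_event k n r) / fact n * x ^ n)"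
  by (rule summable_norm_cancel[OF summable_norm_exp_bound[where B = 1 and K = 1]])
    (simp add: divide_right_mono)

lemma isCont_later_prob: "isCont (later_prob r k) x"
  unfolding later_prob_def
  by (intro continuous_intros isCont_powser_converges_everywhere summable_later_prob)

text \<open>Mixing over the Poisson number of later arrivals supplies the missing x^n / n!.\<close>

lemma later_prob_0: "1 \<le> k \<Longrightarrow> later_prob 0 k x = exp (- x) * kummer (real k) (\<theta> + real k) x"
  by (simp add: later_prob_def kummer_eq kummer_coeff_def prob_mark_count_event_0)

lemma later_prob_1:
  assumes "1 \<le> k"
  shows "later_prob 1 k x = exp (- x) * (\<theta> * kummer_da (real k) (\<theta> + real k) x)"
proof -
  have pos: "0 < real k" "0 < \<theta> + real k"
    using assms theta_pos by auto
  have "(\<Sum>n. prob (mark_count_event k n 1) / fact n * x ^ n) =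
      (\<Sum>n. \<theta> * (kummer_coeff (real k) (\<theta> + real k) n * shifted_harmonic (real k) n * x ^ n))"
    unfolding prob_mark_count_event_1[OF assms]
    by (intro suminf_cong) (simp add: kummer_coeff_def)
  also have "\<dots> = \<theta> * kummer_da (real k) (\<theta> + real k) x"
    unfolding kummer_da_eq[OF pos]
    by (rule suminf_mult[OF summable_norm_cancel[OF summable_kummer_da[OF pos]]])
  finally show ?thesis
    by (simp add: later_prob_def)
qed

section \<open>The observed \<sigma>-algebra and its independence of the future\<close>

lemma success_event: "1 \<le> k \<Longrightarrow> {\<omega> \<in> space M. T k \<omega> \<le> s \<and> X k \<omega>} \<in> events"
  using epoch_event[of k s] mark_event[of k] by (intro sets.sets_Collect_conj)

lemma space_observed [simp]: "space (observed M T X t) = space M"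
  and sets_observed:
    "sets (observed M T X t) = sigma_sets (space M) (arrival_events M T t \<union> success_events M T X t)"
proof -
  have "arrival_events M T t \<union> success_events M T X t \<subseteq> Pow (space M)"
    by (auto simp: arrival_events_def success_events_def)
  then show "space (observed M T X t) = space M"
    "sets (observed M T X t) = sigma_sets (space M) (arrival_events M T t \<union> success_events M T X t)"
    by (simp_all add: observed_def space_measure_of sets_measure_of)
qed

lemma sets_observed_subset: "sets (observed M T X t) \<subseteq> events"
  unfolding sets_observed
  by (intro sets.sigma_sets_subset)
    (auto simp: arrival_events_def success_events_def epoch_event success_event)

lemma sets_observed_mono: "s \<le> t \<Longrightarrow> sets (observed M T X s) \<subseteq> sets (observed M T X t)"
  unfolding sets_observed
  by (intro sigma_sets_mono' Un_mono)
    (fastforce simp: arrival_events_def success_events_def)+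

text \<open>When the count at \<open>u\<close> is \<open>k\<close>, all that is known by then is the
  arrival history and the first \<open>k\<close> marks. Rectangles form a \<pi>-system on which
  probabilities factorise.\<close>

definition history_rectangles :: "real \<Rightarrow> nat \<Rightarrow> 'a set set" where
  "history_rectangles u k = {E \<inter> Y |E Y. E \<in> sets (arrival_history u) \<and> Y \<in> sets (mark_events {1..k})}"

lemma history_rectangles_events: "history_rectangles u k \<subseteq> events"
  using sets_arrival_history_subset[of u] sets_mark_events_subset[of "{1..k}"]
  by (auto simp: history_rectangles_def)

lemma Int_stable_history_rectangles: "Int_stable (history_rectangles u k)"
proof (rule Int_stableI)
  fix a b assume "a \<in> history_rectangles u k" "b \<in> history_rectangles u k"
  then obtain E Y E' Y' where "a = E \<inter> Y" "b = E' \<inter> Y'"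
    "E \<in> sets (arrival_history u)" "E' \<in> sets (arrival_history u)"
    "Y \<in> sets (mark_events {1..k})" "Y' \<in> sets (mark_events {1..k})"
    unfolding history_rectangles_def by blast
  moreover from this have "a \<inter> b = (E \<inter> E') \<inter> (Y \<inter> Y')"
    by blast
  ultimately show "a \<inter> b \<in> history_rectangles u k"
    unfolding history_rectangles_def using sets.Int by blast
qed

text \<open>A success generator with index j > k need not lie in the target \<sigma>-algebra, but it
  becomes empty on the event of exactly \<open>k\<close> arrivals by \<open>u\<close>. Hence the
  induction carries the restriction to this event along.\<close>

lemma observed_Int_arrivals:
  assumes u: "0 \<le> u" "u \<le> 1" and B: "B \<in> sets (observed M T X u)"
  shows "{\<omega> \<in> B. arrivals u \<omega> = k} \<in> sigma_sets (space M) (history_rectangles u k)"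
proof -
  define P where "P = sigma (space M) (history_rectangles u k)"
  have "history_rectangles u k \<subseteq> Pow (space M)"
    using history_rectangles_events sets.sets_into_space by blast
  then have P: "space P = space M" "sets P = sigma_sets (space M) (history_rectangles u k)"
    by (simp_all add: P_def space_measure_of sets_measure_of)
  have arr: "E \<in> sets P" if "E \<in> sets (arrival_history u)" for E
  proof -
    have "E = E \<inter> space M"
      using that sets.sets_into_space by force
    moreover have "space M \<in> sets (mark_events {1..k})"
      using sets.top[of "mark_events {1..k}"] by simp
    ultimately show ?thesis
      unfolding P history_rectangles_def using that by (intro sigma_sets.Basic) blast
  qed
  have mark: "Y \<in> sets P" if "Y \<in> sets (mark_events {1..k})" for Y
  proof -
    have "Y = space M \<inter> Y"
      using that sets.sets_into_space by force
    moreover have "space M \<in> sets (arrival_history u)"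
      using sets.top[of "arrival_history u"] by simp
    ultimately show ?thesis
      unfolding P history_rectangles_def using that by (intro sigma_sets.Basic) blast
  qed
  have N: "{\<omega> \<in> space M. arrivals u \<omega> = k} \<in> sets P"
    using sets_Collect_count_space[OF arrivals_measurable_history[of u u], where P = "\<lambda>n. n = k"] u
    by (intro arr) auto
  have "{\<omega> \<in> B. arrivals u \<omega> = k} \<in> sets P"
    using B unfolding sets_observed
  proof (induction rule: sigma_sets.induct)
    case (Basic a)
    then consider (arrival) j s where "a = {\<omega> \<in> space M. T j \<omega> \<le> s}" "1 \<le> j" "0 \<le> s" "s \<le> u"
      | (success) j s where "a = {\<omega> \<in> space M. T j \<omega> \<le> s \<and> X j \<omega>}" "1 \<le> j" "0 \<le> s" "s \<le> u"
      by (auto simp: arrival_events_def success_events_def)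
    then show ?case
    proof cases
      case arrival
      then have "a \<in> arrival_events M T u"
        by (auto simp: arrival_events_def)
      then have "a \<in> sets P"
        by (intro arr) (simp add: sets_arrival_history)
      then have "a \<inter> {\<omega> \<in> space M. arrivals u \<omega> = k} \<in> sets P"
        using N by (rule sets.Int)
      moreover have "{\<omega> \<in> a. arrivals u \<omega> = k} = a \<inter> {\<omega> \<in> space M. arrivals u \<omega> = k}"
        using arrival by auto
      ultimately show ?thesis
        by simp
    next
      case success
      have le: "j \<le> arrivals u \<omega>" if "\<omega> \<in> space M" "T j \<omega> \<le> s" for \<omega>
        using that epoch_le_iff[of \<omega> j u] success u by auto
      show ?thesis
      proof (cases "j \<le> k")
        case True
        have "{\<omega> \<in> space M. T j \<omega> \<le> s} \<in> arrival_events M T u"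
          using success by (auto simp: arrival_events_def)
        then have "{\<omega> \<in> space M. T j \<omega> \<le> s} \<in> sets P"
          by (intro arr) (simp add: sets_arrival_history)
        moreover have "{\<omega> \<in> space M. X j \<omega>} \<in> sets P"
          using True success by (intro mark mark_event_in) auto
        ultimately have "{\<omega> \<in> space M. T j \<omega> \<le> s} \<inter> {\<omega> \<in> space M. X j \<omega>} \<inter>
            {\<omega> \<in> space M. arrivals u \<omega> = k} \<in> sets P"
          using N by (intro sets.Int)
        moreover have "{\<omega> \<in> a. arrivals u \<omega> = k} = {\<omega> \<in> space M. T j \<omega> \<le> s} \<inter>
            {\<omega> \<in> space M. X j \<omega>} \<inter> {\<omega> \<in> space M. arrivals u \<omega> = k}"
          using success by auto
        ultimately show ?thesis
          by simp
      next
        case False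
        then have "{\<omega> \<in> a. arrivals u \<omega> = k} = {}"
          using le success by auto
        then show ?thesis
          by (simp only: sets.empty_sets)
      qed
    qed
  next
    case Empty
    then show ?case by simp
  next
    case (Compl a)
    have "{\<omega> \<in> space M - a. arrivals u \<omega> = k} =
        {\<omega> \<in> space M. arrivals u \<omega> = k} - {\<omega> \<in> a. arrivals u \<omega> = k}"
      by auto
    then show ?case
      using Compl.IH N by auto
  next
    case (Union a)
    have "{\<omega> \<in> (\<Union>i. a i). arrivals u \<omega> = k} = (\<Union>i. {\<omega> \<in> a i. arrivals u \<omega> = k})"
      by auto
    then show ?case
      using Union.IH by auto
  qed
  then show ?thesis
    by (simp add: P)
qed

text \<open>The locale assumption uses the generators \<open>X k\<close> only; the preimages of all
  sets of truth values generate the same \<sigma>-algebra.\<close>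

lemma prob_arrivals_Int_marks:
  assumes "A \<in> sets (arrival_history 1)" "B \<in> sets (mark_events {1..})"
  shows "prob (A \<inter> B) = prob A * prob B"
proof (rule indep_setD[OF marks_independent_of_arrivals])
  show "A \<in> sigma_sets (space M) (arrival_events M T 1)"
    using assms by (simp add: sets_arrival_history)
  define G where "G = {{\<omega> \<in> space M. X k \<omega>} |k. 1 \<le> k}"
  have G: "G \<subseteq> Pow (space M)"
    by (auto simp: G_def)
  interpret G: sigma_algebra "space M" "sigma_sets (space M) G"
    by (rule sigma_algebra_sigma_sets[OF G])
  have "X k -` S \<inter> space M \<in> sigma_sets (space M) G" if "1 \<le> k" for k S
  proof -
    have X: "{\<omega> \<in> space M. X k \<omega>} \<in> sigma_sets (space M) G"
      using that by (auto simp: G_def)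
    have "X k -` S \<inter> space M = (if True \<in> S then {\<omega> \<in> space M. X k \<omega>} else {}) \<union>
        (if False \<in> S then space M - {\<omega> \<in> space M. X k \<omega>} else {})"
    proof (rule set_eqI)
      show "\<omega> \<in> X k -` S \<inter> space M \<longleftrightarrow> \<omega> \<in> (if True \<in> S then {\<omega> \<in> space M. X k \<omega>} else {}) \<union>
        (if False \<in> S then space M - {\<omega> \<in> space M. X k \<omega>} else {})" for \<omega>
        by (cases "X k \<omega>") auto
    qed
    then show ?thesis
      using X by auto
  qed
  then have "sigma_sets (space M) (\<Union>i\<in>{1..}. {X i -` S \<inter> space M |S. True}) \<subseteq>
      sigma_sets (space M) G"
    by (intro sigma_sets_mono) auto
  then show "B \<in> sigma_sets (space M) {{\<omega> \<in> space M. X k \<omega>} |k. 1 \<le> k}"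
    using assms unfolding sets_mark_events G_def by blast
qed

text \<open>On a rectangle four pieces meet: arrivals before and after \<open>u\<close>, marks up to
  and beyond \<open>k\<close>. Arrivals are separated from marks first, then past from future within
  each kind; a Dynkin argument passes from rectangles to observed events.\<close>

lemma prob_observed_Int_future:
  assumes u: "0 \<le> u" "u < 1" and B: "B \<in> sets (observed M T X u)"
  defines "D n \<equiv> {\<omega> \<in> space M. arrivals 1 \<omega> - arrivals u \<omega> = n}"
  shows "prob ({\<omega> \<in> B. arrivals u \<omega> = k} \<inter> (D n \<inter> mark_count_event k n r)) =
    prob {\<omega> \<in> B. arrivals u \<omega> = k} * (prob (D n) * prob (mark_count_event k n r))"
proof -
  have D: "D n \<in> sets (arrival_history 1)"
    using sets_Collect_count_space[OF arrivals_diff_measurable_history[of u 1 1],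
        where P = "\<lambda>m. m = n"] u by (simp add: D_def)
  have C: "mark_count_event k n r \<in> sets (mark_events {1..})"
    using mark_count_event_in sets_mark_events_mono[OF marks_after_subset] by blast
  have DC: "prob (D n \<inter> mark_count_event k n r) = prob (D n) * prob (mark_count_event k n r)"
    by (rule prob_arrivals_Int_marks[OF D C])
  have "prob ({\<omega> \<in> B. arrivals u \<omega> = k} \<inter> (D n \<inter> mark_count_event k n r)) =
    prob {\<omega> \<in> B. arrivals u \<omega> = k} * prob (D n \<inter> mark_count_event k n r)"
  proof (rule prob_Int_sigma_sets[OF Int_stable_history_rectangles history_rectangles_events])
    show "D n \<inter> mark_count_event k n r \<in> events"
      using D sets_arrival_history_subset[of 1] mark_count_event_events by auto
    show "{\<omega> \<in> B. arrivals u \<omega> = k} \<in> sigma_sets (space M) (history_rectangles u k)"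
      by (rule observed_Int_arrivals) (use u B in auto)
    fix A assume "A \<in> history_rectangles u k"
    then obtain E Y where A: "A = E \<inter> Y" and E: "E \<in> sets (arrival_history u)"
      and Y: "Y \<in> sets (mark_events {1..k})"
      unfolding history_rectangles_def by blast
    have E1: "E \<in> sets (arrival_history 1)"
      using E sets_arrival_history_mono[of u 1] u by auto
    have Y1: "Y \<in> sets (mark_events {1..})"
      using Y sets_mark_events_mono[of "{1..k}" "{1..}"] by auto
    have "A \<inter> (D n \<inter> mark_count_event k n r) = (E \<inter> D n) \<inter> (Y \<inter> mark_count_event k n r)"
      using A by auto
    also have "prob \<dots> = prob (E \<inter> D n) * prob (Y \<inter> mark_count_event k n r)"
      by (intro prob_arrivals_Int_marks sets.Int E1 Y1 D C)
    also have "prob (E \<inter> D n) = prob E * prob (D n)"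
      unfolding D_def by (rule prob_history_increment[OF u E])
    also have "prob (Y \<inter> mark_count_event k n r) = prob Y * prob (mark_count_event k n r)"
      by (rule prob_Int_mark_events[OF _ marks_after_subset _ Y mark_count_event_in]) auto
    also have "prob E * prob (D n) * (prob Y * prob (mark_count_event k n r)) =
        prob A * prob (D n \<inter> mark_count_event k n r)"
      unfolding A DC prob_arrivals_Int_marks[OF E1 Y1] by simp
    finally show "prob (A \<inter> (D n \<inter> mark_count_event k n r)) =
        prob A * prob (D n \<inter> mark_count_event k n r)" .
  qed
  then show ?thesis
    by (simp add: DC)
qed

text \<open>Truncated subtraction covers the case of fewer than \<open>k\<close> arrivals in total,
  where both sides count nothing.\<close>

lemma later_successes_eq:
  assumes \<omega>: "\<omega> \<in> space M"
  shows "later_successes k \<omega> = card {j \<in> {k<..k + (arrivals 1 \<omega> - k)}. X j \<omega>}"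
proof -
  have "T j \<omega> \<le> 1 \<longleftrightarrow> j \<le> k + (arrivals 1 \<omega> - k)" if "k < j" for j
    using that epoch_le_iff[OF \<omega>, of j 1] by auto
  then have "{j. k < j \<and> T j \<omega> \<le> 1 \<and> X j \<omega>} = {j \<in> {k<..k + (arrivals 1 \<omega> - k)}. X j \<omega>}"
    by (intro set_eqI) (simp, blast)
  then show ?thesis
    by (simp add: later_successes_def)
qed

lemma later_successes_measurable:
  "{\<omega> \<in> space M. later_successes k \<omega> = r} \<in> events"
proof -
  have "{\<omega> \<in> space M. later_successes k \<omega> = r} =
      (\<Union>n. {\<omega> \<in> space M. arrivals 1 \<omega> - k = n} \<inter> mark_count_event k n r)"
    by (auto simp: later_successes_eq mark_count_event_def)
  moreover have "{\<omega> \<in> space M. arrivals 1 \<omega> - k = n} \<in> events" for n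
    by (rule sets_Collect_count_space[OF arrivals_measurable]) auto
  ultimately show ?thesis
    using mark_count_event_events by auto
qed

text \<open>The event is split by the number n of arrivals after \<open>u\<close>; on each part the
  later successes are those among the marks k + 1, ..., k + n.\<close>

lemma prob_later_successes_fixed_time:
  assumes u: "0 \<le> u" "u < 1" and B: "B \<in> sets (observed M T X u)"
  shows "prob {\<omega> \<in> B. arrivals u \<omega> = k \<and> later_successes k \<omega> = r} =
    prob {\<omega> \<in> B. arrivals u \<omega> = k} * later_prob r k (rate * (1 - u))"
proof -
  define D where "D n = {\<omega> \<in> space M. arrivals 1 \<omega> - arrivals u \<omega> = n}" for n
  define x where "x = rate * (1 - u)"
  have BM: "B \<subseteq> space M"
    using B sets.sets_into_space[of B "observed M T X u"] by simp
  have Bk: "{\<omega> \<in> B. arrivals u \<omega> = k} \<in> events"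
    using observed_Int_arrivals[OF _ _ B, of k] u
      sets.sigma_sets_subset[OF history_rectangles_events] by auto
  define A where "A n = {\<omega> \<in> B. arrivals u \<omega> = k} \<inter> (D n \<inter> mark_count_event k n r)" for n
  have A_events: "A n \<in> events" for n
    unfolding A_def D_def
    using Bk mark_count_event_events sets_arrival_history_subset[of 1] u
      sets_Collect_count_space[OF arrivals_diff_measurable_history[of u 1 1],
        where P = "\<lambda>m. m = n"] by (intro sets.Int) auto
  have "{\<omega> \<in> B. arrivals u \<omega> = k \<and> later_successes k \<omega> = r} = (\<Union>n. A n)"
    using BM by (auto simp: A_def D_def later_successes_eq mark_count_event_def)
  moreover have "(\<lambda>n. prob (A n)) sums prob (\<Union>n. A n)"
    using A_events by (intro finite_measure_UNION) (auto simp: disjoint_family_on_def A_def D_def)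
  moreover have "prob (A n) = prob {\<omega> \<in> B. arrivals u \<omega> = k} * exp (- x) *
      (prob (mark_count_event k n r) / fact n * x ^ n)" for n
    unfolding A_def D_def prob_observed_Int_future[OF u B] x_def
    using u by (simp add: prob_increment)
  ultimately have "prob {\<omega> \<in> B. arrivals u \<omega> = k \<and> later_successes k \<omega> = r} =
      (\<Sum>n. prob {\<omega> \<in> B. arrivals u \<omega> = k} * exp (- x) *
        (prob (mark_count_event k n r) / fact n * x ^ n))"
    by (simp add: sums_iff)
  also have "\<dots> = prob {\<omega> \<in> B. arrivals u \<omega> = k} * later_prob r k x"
    unfolding later_prob_def by (subst suminf_mult[OF summable_later_prob]) (simp only: mult.assoc)
  finally show ?thesis
    by (simp add: x_def)
qed

end

section \<open>The Markov property at an arrival\<close>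

context last_success_problem
begin

text \<open>The generators only admit s \<ge> 0; for negative \<open>s\<close> the event is empty
  because epochs are positive. Negative values occur below as rational or shifted
  thresholds.\<close>

lemma epoch_event_observed:
  assumes "1 \<le> k" "s \<le> u"
  shows "{\<omega> \<in> space M. T k \<omega> \<le> s} \<in> sets (observed M T X u)"
proof (cases "0 \<le> s")
  case True
  then have "{\<omega> \<in> space M. T k \<omega> \<le> s} \<in> arrival_events M T u"
    using assms by (auto simp: arrival_events_def)
  then show ?thesis
    by (simp add: sets_observed)
next
  case False
  have "{\<omega> \<in> space M. T k \<omega> \<le> s} = {}"
    using False epoch_gt_0[OF _ assms(1)] by fastforce
  then show ?thesis
    by (simp only: sets.empty_sets)
qed

lemma success_event_observed:
  assumes "1 \<le> k" "s \<le> u"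
  shows "{\<omega> \<in> space M. T k \<omega> \<le> s \<and> X k \<omega>} \<in> sets (observed M T X u)"
proof (cases "0 \<le> s")
  case True
  then have "{\<omega> \<in> space M. T k \<omega> \<le> s \<and> X k \<omega>} \<in> success_events M T X u"
    using assms by (auto simp: success_events_def)
  then show ?thesis
    by (simp add: sets_observed)
next
  case False
  have "{\<omega> \<in> space M. T k \<omega> \<le> s \<and> X k \<omega>} = {}"
    using False epoch_gt_0[OF _ assms(1)] by fastforce
  then show ?thesis
    by (simp only: sets.empty_sets)
qed

lemma later_prob_bounded:
  obtains K where "\<And>t. 0 \<le> t \<Longrightarrow> t \<le> 1 \<Longrightarrow> \<bar>later_prob r k (rate * (1 - t))\<bar> \<le> K"
proof -
  have "continuous_on {0..1} (\<lambda>t. later_prob r k (rate * (1 - t)))"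
    by (intro continuous_at_imp_continuous_on ballI isCont_o2[OF _ isCont_later_prob] continuous_intros)
  then have "bounded ((\<lambda>t. later_prob r k (rate * (1 - t))) ` {0..1})"
    by (intro compact_imp_bounded compact_continuous_image) auto
  then obtain K where "\<forall>y\<in>(\<lambda>t. later_prob r k (rate * (1 - t))) ` {0..1}. norm y \<le> K"
    unfolding bounded_iff by blast
  then show ?thesis
    by (intro that[of K]) auto
qed

text \<open>\<open>B\<close> is an event of the stopped \<open>\<sigma>\<close>-algebra at the \<open>k\<close>-th epoch. The epoch is approximated
  from the right by the grid points \<open>i / m\<close>, at which the fixed-time Markov property applies on the
  event that no further arrival precedes the grid point.\<close>

lemma prob_later_successes_epoch:
  assumes k: "1 \<le> k" and B: "B \<in> events" and B1: "\<And>\<omega>. \<omega> \<in> B \<Longrightarrow> T k \<omega> < 1"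
    and hist: "\<And>u. 0 \<le> u \<Longrightarrow> u < 1 \<Longrightarrow> {\<omega> \<in> B. T k \<omega> \<le> u} \<in> sets (observed M T X u)"
  shows "integrable M (\<lambda>\<omega>. indicator B \<omega> * later_prob r k (rate * (1 - T k \<omega>)))"
    and "prob {\<omega> \<in> B. later_successes k \<omega> = r} =
      (\<integral>\<omega>. indicator B \<omega> * later_prob r k (rate * (1 - T k \<omega>)) \<partial>M)"
proof -
  define h where "h t = later_prob r k (rate * (1 - t))" for t
  define R where "R = {\<omega> \<in> space M. later_successes k \<omega> = r}"
  have R: "R \<in> events"
    unfolding R_def by (rule later_successes_measurable)
  have BM: "B \<subseteq> space M"
    using B sets.sets_into_space by blast
  have h_cont: "isCont h t" for t
    unfolding h_def by (intro isCont_o2[OF _ isCont_later_prob] continuous_intros)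
  obtain K where K: "\<And>t. 0 \<le> t \<Longrightarrow> t \<le> 1 \<Longrightarrow> \<bar>h t\<bar> \<le> K"
    unfolding h_def using later_prob_bounded by blast
  \<comment> \<open>The first point at or after the \<open>k\<close>-th epoch on the grid of mesh 1
    / (n + 1).\<close>
  define v where "v n \<omega> = real_of_int \<lceil>real (Suc n) * T k \<omega>\<rceil> / real (Suc n)" for n \<omega>
  define C where "C n i = {\<omega> \<in> B. v n \<omega> = real i / real (Suc n) \<and> arrivals (v n \<omega>) \<omega> = k}" for n i
  define G where "G n = {\<omega> \<in> B. v n \<omega> < 1 \<and> arrivals (v n \<omega>) \<omega> = k}" for n
  have cell_iff: "v n \<omega> = real i / real (Suc n) \<longleftrightarrow>
      T k \<omega> \<le> real i / real (Suc n) \<and> \<not> T k \<omega> \<le> (real i - 1) / real (Suc n)" for n i \<omega>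
  proof -
    have "v n \<omega> = real i / real (Suc n) \<longleftrightarrow> \<lceil>real (Suc n) * T k \<omega>\<rceil> = int i"
      unfolding v_def by (simp add: divide_eq_eq del: of_nat_Suc) linarith
    also have "\<dots> \<longleftrightarrow> real (Suc n) * T k \<omega> \<le> real i \<and> \<not> real (Suc n) * T k \<omega> \<le> real i - 1"
      by linarith
    also have "\<dots> \<longleftrightarrow> T k \<omega> \<le> real i / real (Suc n) \<and> \<not> T k \<omega> \<le> (real i - 1) / real (Suc n)"
      by (simp add: field_simps)
    finally show ?thesis .
  qed
  \<comment> \<open>The index stops at \<open>n\<close> because the fixed-time property needs a time
    below 1; it starts at 1 because epochs are positive.\<close>
  have grid: "0 \<le> real i / real (Suc n)" "real i / real (Suc n) < 1" if "i \<in> {1..n}" for i n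
    using that by auto
  \<comment> \<open>The cell says that the epoch lies in ((i - 1) / (n + 1), i / (n + 1)], which is
    decided at its right end.\<close>
  have cell: "{\<omega> \<in> B. v n \<omega> = real i / real (Suc n)} \<in> sets (observed M T X (real i / real (Suc n)))"
    if "i \<in> {1..n}" for n i
  proof -
    have "{\<omega> \<in> B. T k \<omega> \<le> real i / real (Suc n)} -
        {\<omega> \<in> space M. T k \<omega> \<le> (real i - 1) / real (Suc n)} \<in> sets (observed M T X (real i / real (Suc n)))"
      by (intro sets.Diff hist grid[OF that] epoch_event_observed k divide_right_mono) auto
    moreover have "{\<omega> \<in> B. v n \<omega> = real i / real (Suc n)} = {\<omega> \<in> B. T k \<omega> \<le> real i / real (Suc n)} -
        {\<omega> \<in> space M. T k \<omega> \<le> (real i - 1) / real (Suc n)}"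
      unfolding cell_iff using BM by blast
    ultimately show ?thesis
      by simp
  qed
  have C_eq: "C n i = {\<omega> \<in> {\<omega> \<in> B. v n \<omega> = real i / real (Suc n)}. arrivals (real i / real (Suc n)) \<omega> = k}"
    for n i
    unfolding C_def by auto
  have C_prob: "prob (C n i \<inter> R) = prob (C n i) * h (real i / real (Suc n))" if "i \<in> {1..n}" for n i
  proof -
    have "C n i \<inter> R = {\<omega> \<in> {\<omega> \<in> B. v n \<omega> = real i / real (Suc n)}.
        arrivals (real i / real (Suc n)) \<omega> = k \<and> later_successes k \<omega> = r}"
      unfolding C_eq R_def using BM by auto
    then show ?thesis
      unfolding C_eq h_def
      using prob_later_successes_fixed_time[OF grid[OF that] cell[OF that]] by simp
  qed
  have C_events: "C n i \<in> events" if "i \<in> {1..n}" for n i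
  proof -
    have "{\<omega> \<in> B. v n \<omega> = real i / real (Suc n)} \<inter>
        {\<omega> \<in> space M. arrivals (real i / real (Suc n)) \<omega> = k} \<in> events"
      using cell[OF that] sets_observed_subset grid[OF that]
      by (intro sets.Int sets_Collect_count_space[OF arrivals_measurable]) auto
    moreover have "C n i = {\<omega> \<in> B. v n \<omega> = real i / real (Suc n)} \<inter>
        {\<omega> \<in> space M. arrivals (real i / real (Suc n)) \<omega> = k}"
      using BM unfolding C_eq by auto
    ultimately show ?thesis
      by simp
  qed
  have decomp: "(\<Sum>i\<in>{1..n}. indicator (C n i) \<omega> * f (real i / real (Suc n))) =
      indicator (G n) \<omega> * f (v n \<omega>)" if \<omega>: "\<omega> \<in> space M" for f :: "real \<Rightarrow> real" and n \<omega>
  proof (cases "\<omega> \<in> G n")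
    case True
    define i0 where "i0 = nat \<lceil>real (Suc n) * T k \<omega>\<rceil>"
    have pos: "0 < real (Suc n) * T k \<omega>"
      using epoch_gt_0[OF \<omega> k] by simp
    have i0: "v n \<omega> = real i0 / real (Suc n)"
      using pos by (simp add: v_def i0_def)
    have "1 \<le> i0"
      using pos unfolding i0_def by linarith
    moreover have "v n \<omega> < 1"
      using True by (simp add: G_def)
    then have "real i0 < real (Suc n)"
      unfolding i0 by (subst (asm) divide_less_eq_1_pos) simp_all
    ultimately have mem: "i0 \<in> {1..n}"
      by auto
    have "indicator (C n i) \<omega> * f (real i / real (Suc n)) = (if i = i0 then f (v n \<omega>) else 0)" for i
      using True unfolding C_def G_def i0 by (auto simp: i0 indicator_def)
    then show ?thesis
      using True mem by simp
  next
    case False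
    then have "\<omega> \<notin> C n i" if "i \<in> {1..n}" for i
      using that grid[OF that] unfolding C_def G_def by auto
    then show ?thesis
      using False by simp
  qed
  have v_bounds: "T k \<omega> \<le> v n \<omega>" "v n \<omega> \<le> T k \<omega> + 1 / real (Suc n)" for n \<omega>
  proof -
    have "real (Suc n) * T k \<omega> / real (Suc n) \<le> v n \<omega>"
      "v n \<omega> \<le> (real (Suc n) * T k \<omega> + 1) / real (Suc n)"
      unfolding v_def by (intro divide_right_mono; linarith)+
    then show "T k \<omega> \<le> v n \<omega>" "v n \<omega> \<le> T k \<omega> + 1 / real (Suc n)"
      by (simp_all add: add_divide_distrib del: of_nat_Suc)
  qed
  have v_lim: "(\<lambda>n. v n \<omega>) \<longlonglongrightarrow> T k \<omega>" for \<omega>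
  proof (rule tendsto_sandwich)
    show "(\<lambda>n. T k \<omega>) \<longlonglongrightarrow> T k \<omega>"
      by simp
    have "(\<lambda>n. T k \<omega> + 1 / real (Suc n)) \<longlonglongrightarrow> T k \<omega> + 0"
      by (intro tendsto_add tendsto_const LIMSEQ_Suc lim_1_over_n)
    then show "(\<lambda>n. T k \<omega> + 1 / real (Suc n)) \<longlonglongrightarrow> T k \<omega>"
      by simp
  qed (use v_bounds in auto)
  \<comment> \<open>The grid times tend to an epoch that is below 1 and below its successor, so both
    conditions in \<open>G n\<close> hold eventually.\<close>
  have G_ev: "\<forall>\<^sub>F n in sequentially. \<omega> \<in> G n" if \<omega>: "\<omega> \<in> B" for \<omega>
  proof -
    have "\<forall>\<^sub>F n in sequentially. v n \<omega> < min 1 (T (Suc k) \<omega>)"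
      using B1[OF \<omega>] epoch_less[of \<omega> k "Suc k"] \<omega> BM k
      by (intro order_tendstoD(2)[OF v_lim]) auto
    then show ?thesis
    proof (rule eventually_mono)
      fix n assume n: "v n \<omega> < min 1 (T (Suc k) \<omega>)"
      have "k \<le> arrivals (v n \<omega>) \<omega>" "\<not> Suc k \<le> arrivals (v n \<omega>) \<omega>"
        using n \<omega> BM k v_bounds(1)[of \<omega> n]
          epoch_le_iff[of \<omega> k "v n \<omega>"] epoch_le_iff[of \<omega> "Suc k" "v n \<omega>"] by auto
      then show "\<omega> \<in> G n"
        using n \<omega> by (auto simp: G_def)
    qed
  qed
  have G_lim: "(\<lambda>n. indicator (G n) \<omega> * f n :: real) \<longlonglongrightarrow> indicator B \<omega> * L" if "f \<longlonglongrightarrow> L" for \<omega> f L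
  proof (cases "\<omega> \<in> B")
    case True
    then have "\<forall>\<^sub>F n in sequentially. f n = indicator (G n) \<omega> * f n"
      using G_ev[OF True] by (auto elim: eventually_mono)
    then have "(\<lambda>n. indicator (G n) \<omega> * f n) \<longlonglongrightarrow> L"
      by (rule Lim_transform_eventually[OF that])
    then show ?thesis
      using True by simp
  next
    case False
    then have "indicator (G n) \<omega> = (0::real)" for n
      by (auto simp: G_def)
    then show ?thesis
      using False by simp
  qed
  \<comment> \<open>\<open>S n\<close> carries the conditional probabilities at the grid times,
    \<open>S' n\<close> the event itself. By \<open>C_prob\<close> their integrals agree for every
    \<open>n\<close>, and dominated convergence takes both to the epoch.\<close>
  define S where "S n \<omega> = (\<Sum>i\<in>{1..n}. indicator (C n i) \<omega> * h (real i / real (Suc n)))" for n \<omega>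
  define S' where "S' n \<omega> = (\<Sum>i\<in>{1..n}. indicator (C n i \<inter> R) \<omega> :: real)" for n \<omega>
  have S_eq: "S n \<omega> = indicator (G n) \<omega> * h (v n \<omega>)" if "\<omega> \<in> space M" for n \<omega>
    unfolding S_def using decomp[OF that] .
  have S'_eq: "S' n \<omega> = indicator (G n) \<omega> * indicator R \<omega>" if "\<omega> \<in> space M" for n \<omega>
    unfolding S'_def using decomp[OF that, of n "\<lambda>_. 1"]
    by (simp add: indicator_inter_arith sum_distrib_right[symmetric])
  have S_bound: "norm (S n \<omega>) \<le> max K 0" if "\<omega> \<in> space M" for n \<omega>
    using K[of "v n \<omega>"] v_bounds(1)[of \<omega> n] epoch_gt_0[OF that k] S_eq[OF that, of n]
    by (auto simp: indicator_def G_def)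
  have S_meas: "S n \<in> borel_measurable M" for n
    unfolding S_def using C_events
    by (intro borel_measurable_sum borel_measurable_times borel_measurable_indicator) auto
  have S'_meas: "S' n \<in> borel_measurable M" for n
    unfolding S'_def using C_events R
    by (intro borel_measurable_sum borel_measurable_indicator) auto
  have h_meas: "h \<in> borel_measurable borel"
    using h_cont by (intro borel_measurable_continuous_onI continuous_at_imp_continuous_on) auto
  have f_meas: "(\<lambda>\<omega>. indicator B \<omega> * h (T k \<omega>)) \<in> borel_measurable M"
    using B by (intro borel_measurable_times borel_measurable_indicator
        measurable_compose[OF epoch_measurable[OF k] h_meas])
  have f'_meas: "(\<lambda>\<omega>. indicator B \<omega> * indicator R \<omega> :: real) \<in> borel_measurable M"
    using B R by (intro borel_measurable_times borel_measurable_indicator)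
  have S_lim: "AE \<omega> in M. (\<lambda>n. S n \<omega>) \<longlonglongrightarrow> indicator B \<omega> * h (T k \<omega>)"
    by (rule AE_I2) (simp add: S_eq G_lim isCont_tendsto_compose[OF h_cont] v_lim)
  have S'_lim: "AE \<omega> in M. (\<lambda>n. S' n \<omega>) \<longlonglongrightarrow> indicator B \<omega> * indicator R \<omega>"
    by (rule AE_I2) (simp add: S'_eq G_lim)
  have S_AE: "\<And>n. AE \<omega> in M. norm (S n \<omega>) \<le> max K 0"
    by (rule AE_I2) (rule S_bound)
  have S'_AE: "\<And>n. AE \<omega> in M. norm (S' n \<omega>) \<le> 1"
    by (rule AE_I2) (simp add: S'_eq indicator_def)
  have lim: "(\<lambda>n. integral\<^sup>L M (S n)) \<longlonglongrightarrow> (\<integral>\<omega>. indicator B \<omega> * h (T k \<omega>) \<partial>M)"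
    by (rule integral_dominated_convergence[OF f_meas S_meas _ S_lim S_AE]) simp
  have lim': "(\<lambda>n. integral\<^sup>L M (S' n)) \<longlonglongrightarrow> (\<integral>\<omega>. indicator B \<omega> * indicator R \<omega> \<partial>M)"
    by (rule integral_dominated_convergence[OF f'_meas S'_meas _ S'_lim S'_AE]) simp
  have "integral\<^sup>L M (S n) = integral\<^sup>L M (S' n)" for n
  proof -
    have int: "integrable M (indicator A :: _ \<Rightarrow> real)" if "A \<in> events" for A
      using that by (intro integrable_real_indicator) (simp_all add: less_top[symmetric])
    have "integral\<^sup>L M (S n) = (\<Sum>i\<in>{1..n}. prob (C n i) * h (real i / real (Suc n)))"
      unfolding S_def using C_events
      by (subst Bochner_Integration.integral_sum) (auto intro!: sum.cong simp: int)
    also have "\<dots> = (\<Sum>i\<in>{1..n}. prob (C n i \<inter> R))"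
      by (intro sum.cong) (simp_all add: C_prob)
    also have "\<dots> = integral\<^sup>L M (S' n)"
      unfolding S'_def using C_events R
      by (subst Bochner_Integration.integral_sum) (auto intro!: sum.cong int)
    finally show ?thesis .
  qed
  then have "(\<integral>\<omega>. indicator B \<omega> * indicator R \<omega> \<partial>M) = (\<integral>\<omega>. indicator B \<omega> * h (T k \<omega>) \<partial>M)"
    using lim lim' by (intro LIMSEQ_unique[OF lim']) simp
  moreover have "(\<lambda>\<omega>. indicator B \<omega> * indicator R \<omega> :: real) = indicator (B \<inter> R)"
    by (auto simp: indicator_def)
  moreover have "{\<omega> \<in> B. later_successes k \<omega> = r} = B \<inter> R"
    using BM by (auto simp: R_def)
  ultimately show "prob {\<omega> \<in> B. later_successes k \<omega> = r} =
      (\<integral>\<omega>. indicator B \<omega> * later_prob r k (rate * (1 - T k \<omega>)) \<partial>M)"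
    using B R unfolding h_def by simp
  show "integrable M (\<lambda>\<omega>. indicator B \<omega> * later_prob r k (rate * (1 - T k \<omega>)))"
    using integrable_dominated_convergence[OF f_meas S_meas _ S_lim S_AE] unfolding h_def by simp
qed

lemma prob_later_successes_mono:
  assumes k: "1 \<le> k" and B: "B \<in> events" and B1: "\<And>\<omega>. \<omega> \<in> B \<Longrightarrow> T k \<omega> < 1"
    and hist: "\<And>u. 0 \<le> u \<Longrightarrow> u < 1 \<Longrightarrow> {\<omega> \<in> B. T k \<omega> \<le> u} \<in> sets (observed M T X u)"
    and le: "\<And>\<omega>. \<omega> \<in> B \<Longrightarrow>
      later_prob r k (rate * (1 - T k \<omega>)) \<le> later_prob r' k (rate * (1 - T k \<omega>))"
  shows "prob {\<omega> \<in> B. later_successes k \<omega> = r} \<le> prob {\<omega> \<in> B. later_successes k \<omega> = r'}"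
  unfolding prob_later_successes_epoch(2)[OF k B B1 hist, simplified]
  by (intro integral_mono prob_later_successes_epoch(1)[OF k B B1 hist])
    (auto simp: indicator_def le)

end

section \<open>Optimality of the threshold rule\<close>

lemma card_greater_eq_0_iff_Max:
  fixes S :: "nat set"
  assumes "finite S" "k \<in> S"
  shows "card {j \<in> S. k < j} = 0 \<longleftrightarrow> k = Max S"
proof -
  have "card {j \<in> S. k < j} = 0 \<longleftrightarrow> (\<forall>j\<in>S. j \<le> k)"
    using assms by (auto simp: not_less)
  also have "\<dots> \<longleftrightarrow> k = Max S"
    using assms by (auto intro: Max_eqI[symmetric])
  finally show ?thesis .
qed

text \<open>Removing the maximum lowers the count of larger elements by one and so reduces the claim
  to the case of the last element.\<close>

lemma card_greater_eq_1_iff_Max: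
  fixes S :: "nat set"
  assumes "finite S" "k \<in> S" "S - {Max S} \<noteq> {}"
  shows "card {j \<in> S. k < j} = 1 \<longleftrightarrow> k = Max (S - {Max S})"
proof (cases "k = Max S")
  case True
  then have "card {j \<in> S. k < j} = 0"
    using card_greater_eq_0_iff_Max[OF assms(1,2)] by simp
  moreover have "Max (S - {Max S}) \<noteq> Max S"
    using Max_in[of "S - {Max S}"] assms by auto
  ultimately show ?thesis
    using True by simp
next
  case False
  have "S \<noteq> {}"
    using assms by auto
  then have max: "Max S \<in> S"
    using assms by simp
  have "k < Max S"
    using False Max_ge[OF assms(1,2)] by linarith
  then have "{j \<in> S. k < j} = insert (Max S) {j \<in> S - {Max S}. k < j}"
    using max by auto
  then have "card {j \<in> S. k < j} = Suc (card {j \<in> S - {Max S}. k < j})"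
    using assms by simp
  then show ?thesis
    using card_greater_eq_0_iff_Max[of "S - {Max S}" k] assms False by simp
qed

context last_success_problem
begin

section \<open>Adaptedness of the threshold rule\<close>

abbreviation good :: "'a \<Rightarrow> nat \<Rightarrow> bool" where
  "good \<equiv> threshold_success rate (kummer_root \<theta>) T X"

abbreviation rule_time :: "'a \<Rightarrow> real" where
  "rule_time \<equiv> threshold_rule rate (kummer_root \<theta>) T X"

text \<open>The threshold condition has the form T j \<ge> t, while the generators are of the form T
  j \<le> s. Its negation T j < t is therefore written as a countable union of events T j \<le> t -
  1 / (n + 1).\<close>

lemma good_observed:
  assumes "1 \<le> j" "u \<le> 1"
  shows "{\<omega> \<in> space M. good \<omega> j \<and> T j \<omega> \<le> u} \<in> sets (observed M T X u)"
proof -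
  define t where "t = 1 - kummer_root \<theta> j / rate"
  have less_iff: "y < t \<longleftrightarrow> (\<exists>n. y \<le> t - 1 / real (Suc n))" for y
  proof
    assume "y < t"
    then obtain n where "inverse (real (Suc n)) < t - y"
      using reals_Archimedean[of "t - y"] by auto
    then show "\<exists>n. y \<le> t - 1 / real (Suc n)"
      by (intro exI[of _ n]) (simp add: inverse_eq_divide)
  next
    assume "\<exists>n. y \<le> t - 1 / real (Suc n)"
    then obtain n where "y \<le> t - 1 / real (Suc n)" by blast
    moreover have "0 < 1 / real (Suc n)"
      by simp
    ultimately show "y < t"
      by linarith
  qed
  have "(1 - y) * rate \<le> kummer_root \<theta> j \<longleftrightarrow> \<not> y < t" for y
    using rate_pos by (auto simp: t_def field_simps)
  then have "{\<omega> \<in> space M. good \<omega> j \<and> T j \<omega> \<le> u} = {\<omega> \<in> space M. T j \<omega> \<le> u \<and> X j \<omega>} -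
      (\<Union>n. {\<omega> \<in> space M. T j \<omega> \<le> min u (t - 1 / real (Suc n)) \<and> X j \<omega>})"
    using assms unfolding threshold_success_def less_iff by auto
  moreover have "{\<omega> \<in> space M. T j \<omega> \<le> min u (t - 1 / real (Suc n)) \<and> X j \<omega>} \<in>
      sets (observed M T X u)" for n
    using assms by (intro success_event_observed) auto
  moreover have "{\<omega> \<in> space M. T j \<omega> \<le> u \<and> X j \<omega>} \<in> sets (observed M T X u)"
    using assms by (intro success_event_observed) auto
  ultimately show ?thesis
    by (simp only:) (intro sets.Diff sets.countable_UN image_subsetI)
qed

lemma good_events: "1 \<le> j \<Longrightarrow> {\<omega> \<in> space M. good \<omega> j} \<in> events"
proof -
  assume j: "1 \<le> j"
  have "{\<omega> \<in> space M. good \<omega> j} = {\<omega> \<in> space M. good \<omega> j \<and> T j \<omega> \<le> 1}"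
    by (auto simp: threshold_success_def)
  then show ?thesis
    using good_observed[OF j, of 1] sets_observed_subset[of 1] by auto
qed

lemma rule_time_cases:
  assumes "\<omega> \<in> space M"
  shows "(\<exists>k. good \<omega> k \<and> rule_time \<omega> = T k \<omega> \<and> (\<forall>j. good \<omega> j \<longrightarrow> k \<le> j)) \<or>
    (\<forall>j. \<not> good \<omega> j) \<and> rule_time \<omega> = 1"
proof (cases "\<exists>k. good \<omega> k")
  case True
  then have "good \<omega> (LEAST k. good \<omega> k)" "rule_time \<omega> = T (LEAST k. good \<omega> k) \<omega>"
    by (auto simp: threshold_rule_def intro: LeastI)
  then show ?thesis
    by (auto intro: Least_le)
qed (simp add: threshold_rule_def)

text \<open>The restriction to t < 1 is essential: the value 1 also stands for not stopping.\<close>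

lemma rule_time_le_iff:
  assumes \<omega>: "\<omega> \<in> space M" and "t < 1"
  shows "rule_time \<omega> \<le> t \<longleftrightarrow> (\<exists>j\<ge>1. good \<omega> j \<and> T j \<omega> \<le> t)"
  using rule_time_cases[OF \<omega>]
proof (elim disjE exE conjE)
  fix k assume k: "good \<omega> k" "rule_time \<omega> = T k \<omega>" "\<forall>j. good \<omega> j \<longrightarrow> k \<le> j"
  have "1 \<le> k"
    using k by (simp add: threshold_success_def)
  have "T k \<omega> \<le> t" if "good \<omega> j" "T j \<omega> \<le> t" for j
    using epoch_mono[OF \<omega> \<open>1 \<le> k\<close>, of j] k that by force
  then show ?thesis
    using k \<open>1 \<le> k\<close> by auto
qed (use assms in auto)

lemma stopping_strategy_rule_time: "stopping_strategy M T X rule_time"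
  unfolding stopping_strategy_def
proof (intro conjI ballI)
  have le: "{\<omega> \<in> space M. rule_time \<omega> \<le> t} \<in> sets (observed M T X t)" for t
  proof (cases "t < 1")
    case True
    have "{\<omega> \<in> space M. rule_time \<omega> \<le> t} = (\<Union>j\<in>{1..}. {\<omega> \<in> space M. good \<omega> j \<and> T j \<omega> \<le> t})"
      using rule_time_le_iff[OF _ True] by auto
    also have "\<dots> \<in> sets (observed M T X t)"
      using True good_observed[of _ t] by (intro sets.countable_UN') auto
    finally show ?thesis .
  next
    case False
    have "rule_time \<omega> \<le> 1" if "\<omega> \<in> space M" for \<omega>
      using rule_time_cases[OF that] by (auto simp: threshold_success_def)
    then have "{\<omega> \<in> space M. rule_time \<omega> \<le> t} = space M"
      using False by force
    then show ?thesis
      using sets.top[of "observed M T X t"] by simp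
  qed
  show "rule_time \<in> borel_measurable M"
    using le sets_observed_subset by (intro borel_measurableI_le) blast
  show "stopping_time (observed M T X) rule_time"
    using le by (intro stopping_timeI) (simp add: pred_def)
  fix \<omega> assume \<omega>: "\<omega> \<in> space M"
  then show "rule_time \<omega> \<in> {T k \<omega> |k. 1 \<le> k \<and> k \<le> arrivals 1 \<omega>} \<union> {1}"
    using rule_time_cases[OF \<omega>] epoch_le_iff[OF \<omega>, of _ 1]
    by (auto simp: threshold_success_def)
qed

section \<open>From a single epoch to all epochs, and the pathwise inequality\<close>

lemma later_successes_less:
  assumes "\<omega> \<in> space M" "k < j" "T j \<omega> \<le> 1" "X j \<omega>"
  shows "later_successes j \<omega> < later_successes k \<omega>"
  unfolding later_successes_def
proof (rule psubset_card_mono)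
  show "finite {i. k < i \<and> T i \<omega> \<le> 1 \<and> X i \<omega>}"
    by (rule finite_subset[OF _ finitely_many_arrivals[OF assms(1)]]) auto
  show "{i. j < i \<and> T i \<omega> \<le> 1 \<and> X i \<omega>} \<subset> {i. k < i \<and> T i \<omega> \<le> 1 \<and> X i \<omega>}"
    using assms by auto
qed

lemma win_event_eq:
  "win_event M T X \<sigma> =
    (\<Union>k\<in>{1..}. {\<omega> \<in> space M. T k \<omega> < 1 \<and> \<sigma> \<omega> = T k \<omega> \<and> X k \<omega> \<and> later_successes k \<omega> = 0})"
proof -
  have "\<not> (\<exists>j\<ge>1. T k \<omega> < T j \<omega> \<and> T j \<omega> \<le> 1 \<and> X j \<omega>) \<longleftrightarrow> later_successes k \<omega> = 0"
    if "\<omega> \<in> space M" "1 \<le> k" for k \<omega>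
  proof -
    have fin: "finite {j. k < j \<and> T j \<omega> \<le> 1 \<and> X j \<omega>}"
      by (rule finite_subset[OF _ finitely_many_arrivals[OF that(1)]]) auto
    have "T k \<omega> < T j \<omega> \<longleftrightarrow> k < j" if "1 \<le> j" for j
      using epoch_less[OF \<open>\<omega> \<in> space M\<close> \<open>1 \<le> k\<close>, of j]
        epoch_mono[OF \<open>\<omega> \<in> space M\<close> that, of k] by force
    then show ?thesis
      using fin that(2) by (auto simp: later_successes_def)
  qed
  then show ?thesis
    unfolding win_event_def by auto
qed

text \<open>No two successes are followed by the same number of successes. For fixed
  \<open>r\<close> the events at different epochs are therefore disjoint, and the union is compared
  term by term.\<close>

lemma prob_union_over_epochs_mono:
  fixes B :: "nat \<Rightarrow> 'a set"
  assumes sub: "\<And>k. 1 \<le> k \<Longrightarrow> B k \<subseteq> {\<omega> \<in> space M. T k \<omega> \<le> 1 \<and> X k \<omega>}"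
    and events: "\<And>k. 1 \<le> k \<Longrightarrow> B k \<in> events"
    and le: "\<And>k. 1 \<le> k \<Longrightarrow> prob {\<omega> \<in> B k. later_successes k \<omega> = r} \<le>
      prob {\<omega> \<in> B k. later_successes k \<omega> = r'}"
  shows "prob (\<Union>k\<in>{1..}. {\<omega> \<in> B k. later_successes k \<omega> = r}) \<le>
    prob (\<Union>k\<in>{1..}. {\<omega> \<in> B k. later_successes k \<omega> = r'})"
proof -
  have sums: "(\<lambda>n. prob {\<omega> \<in> B (Suc n). later_successes (Suc n) \<omega> = q}) sums
      prob (\<Union>k\<in>{1..}. {\<omega> \<in> B k. later_successes k \<omega> = q})" for q
  proof -
    define A where "A n = {\<omega> \<in> B (Suc n). later_successes (Suc n) \<omega> = q}" for n
    have "A n \<in> events" for n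
    proof -
      have "A n = B (Suc n) \<inter> {\<omega> \<in> space M. later_successes (Suc n) \<omega> = q}"
        using sub[of "Suc n"] by (auto simp: A_def)
      then show ?thesis
        using events[of "Suc n"] later_successes_measurable by auto
    qed
    moreover have "A m \<inter> A n = {}" if "m < n" for m n
    proof -
      have "later_successes (Suc n) \<omega> \<noteq> later_successes (Suc m) \<omega>" if "\<omega> \<in> B (Suc n)" for \<omega>
        using later_successes_less[of \<omega> "Suc m" "Suc n"] sub[of "Suc n"] that \<open>m < n\<close> by auto
      then show ?thesis
        unfolding A_def by blast
    qed
    then have "disjoint_family A"
      unfolding disjoint_family_on_def by (metis inf_commute linorder_neqE_nat)
    ultimately have "(\<lambda>n. prob (A n)) sums prob (\<Union>n. A n)"
      by (intro finite_measure_UNION) auto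
    moreover have "(\<Union>n. A n) = (\<Union>k\<in>Suc ` UNIV. {\<omega> \<in> B k. later_successes k \<omega> = q})"
      by (simp add: A_def)
    moreover have "Suc ` UNIV = {1..}"
      by (auto simp: image_iff) (metis Suc_le_D)
    ultimately show ?thesis
      by (simp add: A_def)
  qed
  show ?thesis
    by (rule sums_le[OF _ sums sums]) (simp add: le)
qed

text \<open>\<open>succ 0 P\<close> and \<open>succ 1 P\<close> evaluate \<open>P\<close> at the
  last and the penultimate success, and \<open>U k\<close> says that the rule has stopped by the
  \<open>k\<close>-th arrival. Subtracted terms are moved across, so both sides are sums of
  indicators.\<close>

lemma win_indicator_bound:
  fixes \<sigma> :: real
  assumes \<omega>: "\<omega> \<in> space M" and neq: "\<And>k. 1 \<le> k \<Longrightarrow> T k \<omega> \<noteq> 1"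
  defines "succ r P \<equiv> \<exists>k\<ge>1. T k \<omega> < 1 \<and> X k \<omega> \<and> later_successes k \<omega> = r \<and> P k"
    and "U k \<equiv> \<exists>j\<in>{1..k}. good \<omega> j"
  shows "of_bool (succ 0 (\<lambda>k. \<sigma> = T k \<omega>)) + of_bool (succ 0 (\<lambda>k. U k \<and> T k \<omega> < \<sigma>)) +
      of_bool (succ 1 (\<lambda>k. \<not> U k \<and> \<sigma> \<le> T k \<omega>)) \<le>
    of_bool (succ 0 (\<lambda>k. rule_time \<omega> = T k \<omega>)) + of_bool (succ 1 (\<lambda>k. U k \<and> T k \<omega> < \<sigma>)) +
      (of_bool (succ 0 (\<lambda>k. \<not> U k \<and> \<sigma> \<le> T k \<omega>)) :: real)"
proof -
  define S where "S = {k. 1 \<le> k \<and> T k \<omega> \<le> 1 \<and> X k \<omega>}"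
  have fin: "finite S"
    unfolding S_def by (rule finite_subset[OF _ finitely_many_arrivals[OF \<omega>]]) auto
  have later: "later_successes k \<omega> = card {j \<in> S. k < j}" if "k \<in> S" for k
    unfolding later_successes_def using that by (intro arg_cong[of _ _ card]) (auto simp: S_def)
  have S: "k \<in> S \<longleftrightarrow> 1 \<le> k \<and> T k \<omega> < 1 \<and> X k \<omega>" for k
    using neq[of k] by (auto simp: S_def)
  then have succ_S: "succ r P \<longleftrightarrow> (\<exists>k\<in>S. card {j \<in> S. k < j} = r \<and> P k)" for r P
    unfolding succ_def using later by auto
  have good_S: "good \<omega> k \<Longrightarrow> k \<in> S" for k
    by (auto simp: threshold_success_def S_def)
  show ?thesis
  proof (cases "S = {}")
    case True
    then show ?thesis
      by (simp add: succ_S)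
  next
    case False
    define l where "l = Max S"
    have l: "l \<in> S" "\<And>k. k \<in> S \<Longrightarrow> k \<le> l"
      using fin False by (auto simp: l_def)
    have succ_0: "succ 0 P \<longleftrightarrow> P l" for P
      using card_greater_eq_0_iff_Max[OF fin] l unfolding succ_S l_def[symmetric] by blast
    have rule_l: "rule_time \<omega> = T l \<omega>" if Ul: "U l" and none: "\<And>k. k \<in> S \<Longrightarrow> k < l \<Longrightarrow> \<not> good \<omega> k"
    proof -
      obtain k where "good \<omega> k" "rule_time \<omega> = T k \<omega>"
        using rule_time_cases[OF \<omega>] Ul by (auto simp: U_def)
      then show ?thesis
        using none[of k] good_S[of k] l(2)[of k] by (cases "k = l") auto
    qed
    show ?thesis
    proof (cases "S - {l} = {}")
      case True
      then have only: "S = {l}"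
        using l by blast
      then have "card {j \<in> S. k < j} \<noteq> 1" if "k \<in> S" for k
      proof -
        have "k = Max S"
          using that only by simp
        then show ?thesis
          using card_greater_eq_0_iff_Max[OF fin that] by simp
      qed
      then have "\<not> succ 1 P" for P
        unfolding succ_S by blast
      moreover have "U l \<Longrightarrow> rule_time \<omega> = T l \<omega>"
        using rule_l only by auto
      ultimately show ?thesis
        by (auto simp: succ_0)
    next
      case False
      define p where "p = Max (S - {l})"
      have "p \<in> S - {l}"
        unfolding p_def using fin False by (intro Max_in) auto
      then have p: "p \<in> S" "p < l"
        using l(2)[of p] by auto
      have p_max: "k \<le> p" if "k \<in> S" "k < l" for k
        unfolding p_def using fin that by (intro Max_ge) auto
      have succ_1: "succ 1 P \<longleftrightarrow> P p" for P
        using card_greater_eq_1_iff_Max[OF fin] False p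
        unfolding succ_S l_def[symmetric] p_def[symmetric] by blast
      have "T p \<omega> < T l \<omega>"
        using epoch_less[OF \<omega> _ p(2)] p by (simp add: S_def)
      moreover have "U p \<Longrightarrow> U l"
        using p by (auto simp: U_def)
      moreover have "rule_time \<omega> = T l \<omega>" if "U l" "\<not> U p"
        using that p_max by (intro rule_l) (auto simp: U_def S_def)
      \<comment> \<open>If \<open>U p\<close>, then stopping at l and passing l both require
        \<sigma> to pass p. If only \<open>U l\<close>, the rule stops at l, and the three events on
        the left exclude one another. If not even \<open>U l\<close>, the remaining left events
        \<sigma> = T l and \<sigma> \<le> T p are disjoint and both lie in \<sigma> \<le> T
        l.\<close>
      ultimately show ?thesis
        unfolding succ_0 succ_1 by (cases "U p"; cases "U l") auto
    qed
  qed
qed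

lemma optimal_strategy_rule_time: "optimal_strategy M T X rule_time"
  unfolding optimal_strategy_def
proof (intro conjI allI impI)
  show "stopping_strategy M T X rule_time"
    by (rule stopping_strategy_rule_time)
  fix \<sigma> assume "stopping_strategy M T X \<sigma>"
  then have \<sigma>_meas: "\<sigma> \<in> borel_measurable M" and \<sigma>: "stopping_time (observed M T X) \<sigma>"
    by (auto simp: stopping_strategy_def)
  have rule_meas: "rule_time \<in> borel_measurable M"
    using stopping_strategy_rule_time by (simp add: stopping_strategy_def)
  define U where "U k \<omega> \<longleftrightarrow> (\<exists>j\<in>{1..k}. good \<omega> j)" for k \<omega>
  \<comment> \<open>\<open>B k\<close> is a success, from the rule's stopping point on, that
    \<sigma> passes; \<open>B' k\<close> is a success before that point which comes at or after
    \<sigma>. Both are decided at the \<open>k\<close>-th epoch.\<close>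
  define B where "B k = {\<omega> \<in> space M. T k \<omega> < 1 \<and> X k \<omega> \<and> U k \<omega> \<and> T k \<omega> < \<sigma> \<omega>}" for k
  define B' where "B' k = {\<omega> \<in> space M. T k \<omega> < 1 \<and> X k \<omega> \<and> \<not> U k \<omega> \<and> \<sigma> \<omega> \<le> T k \<omega>}" for k
  define W where "W r B = (\<Union>k\<in>{1..}. {\<omega> \<in> B k. later_successes k \<omega> = r})"
    for r and B :: "nat \<Rightarrow> 'a set"
  have U_events: "{\<omega> \<in> space M. U k \<omega>} \<in> events" for k
    unfolding U_def by (intro sets.sets_Collect_finite_Ex good_events) auto
  have T_events: "{\<omega> \<in> space M. T k \<omega> < 1} \<in> events" if "1 \<le> k" for k
    using epoch_measurable[OF that] by simp
  have before: "{\<omega> \<in> space M. T k \<omega> < \<sigma> \<omega>} \<in> events" if "1 \<le> k" for k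
    using epoch_measurable[OF that] \<sigma>_meas by simp
  have B_eq: "B k = {\<omega> \<in> space M. T k \<omega> < 1} \<inter> {\<omega> \<in> space M. X k \<omega>} \<inter> {\<omega> \<in> space M. U k \<omega>} \<inter>
      {\<omega> \<in> space M. T k \<omega> < \<sigma> \<omega>}" for k
    by (auto simp: B_def)
  have B'_eq: "B' k = ({\<omega> \<in> space M. T k \<omega> < 1} \<inter> {\<omega> \<in> space M. X k \<omega>} - {\<omega> \<in> space M. U k \<omega>}) -
      {\<omega> \<in> space M. T k \<omega> < \<sigma> \<omega>}" for k
    by (auto simp: B'_def)
  have B_events: "B k \<in> events" "B' k \<in> events" if "1 \<le> k" for k
    unfolding B_eq B'_eq
    by (intro sets.Int sets.Diff T_events mark_event U_events before that)+
  have hist: "{\<omega> \<in> B k. T k \<omega> \<le> u} \<in> sets (observed M T X u)"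
    "{\<omega> \<in> B' k. T k \<omega> \<le> u} \<in> sets (observed M T X u)" if k: "1 \<le> k" and u: "u < 1" for k u
  proof -
    define A1 where "A1 = {\<omega> \<in> space M. T k \<omega> \<le> u \<and> X k \<omega>}"
    define A2 where "A2 = (\<Union>j\<in>{1..k}. {\<omega> \<in> space M. good \<omega> j \<and> T j \<omega> \<le> u})"
    \<comment> \<open>On T k \<le> u, the relation T k < \<sigma> is witnessed by some q \<le> u
      with T k \<le> q < \<sigma>: a rational if \<sigma> \<le> u, and \<open>u\<close> itself
      otherwise. Each witness uses only events observed by time q.\<close>
    define A3 where "A3 = (\<Union>q\<in>{q \<in> insert u \<rat>. q \<le> u}. {\<omega> \<in> space M. T k \<omega> \<le> q} - {\<omega> \<in> space M. \<sigma> \<omega> \<le> q})"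
    have A1: "A1 \<in> sets (observed M T X u)"
      unfolding A1_def using k by (intro success_event_observed) auto
    have A2: "A2 \<in> sets (observed M T X u)"
      unfolding A2_def using u by (intro sets.finite_UN good_observed) auto
    have A3: "A3 \<in> sets (observed M T X u)"
    proof -
      have "countable {q \<in> insert u \<rat>. q \<le> u}"
        by (rule countable_subset[of _ "insert u \<rat>"]) (auto simp: countable_rat)
      moreover have "{\<omega> \<in> space M. T k \<omega> \<le> q} - {\<omega> \<in> space M. \<sigma> \<omega> \<le> q} \<in> sets (observed M T X u)"
        if "q \<le> u" for q
        using stopping_timeD[OF \<sigma>, of q] sets_observed_mono[OF that] epoch_event_observed[OF k that]
        by (intro sets.Diff) (auto simp: pred_def)
      ultimately show ?thesis
        unfolding A3_def by (intro sets.countable_UN') auto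
    qed
    have A2_iff: "\<omega> \<in> A2 \<longleftrightarrow> U k \<omega>" if "\<omega> \<in> A1" for \<omega>
    proof -
      have "T j \<omega> \<le> u" if "j \<in> {1..k}" for j
        using epoch_mono[of \<omega> j k] that \<open>\<omega> \<in> A1\<close> by (auto simp: A1_def)
      then show ?thesis
        using that by (auto simp: A2_def U_def A1_def)
    qed
    have A3_iff: "\<omega> \<in> A3 \<longleftrightarrow> T k \<omega> < \<sigma> \<omega>" if "\<omega> \<in> A1" for \<omega>
    proof
      assume less: "T k \<omega> < \<sigma> \<omega>"
      show "\<omega> \<in> A3"
      proof (cases "u < \<sigma> \<omega>")
        case True
        then show ?thesis
          using that by (auto simp: A3_def A1_def)
      next
        case False
        obtain q where "q \<in> \<rat>" "T k \<omega> < q" "q < \<sigma> \<omega>"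
          using Rats_dense_in_real[OF less] by blast
        then show ?thesis
          using False that by (force simp: A3_def A1_def)
      qed
    qed (auto simp: A3_def)
    have "{\<omega> \<in> B k. T k \<omega> \<le> u} = A1 \<inter> A2 \<inter> A3" "{\<omega> \<in> B' k. T k \<omega> \<le> u} = A1 - A2 - A3"
      using A2_iff A3_iff u by (auto simp: B_def B'_def A1_def not_less)
    then show "{\<omega> \<in> B k. T k \<omega> \<le> u} \<in> sets (observed M T X u)"
      "{\<omega> \<in> B' k. T k \<omega> \<le> u} \<in> sets (observed M T X u)"
      using A1 A2 A3 by auto
  qed
  have root_mono: "kummer_root \<theta> j \<le> kummer_root \<theta> k" if "1 \<le> j" "j \<le> k" for j k
    using strict_mono_on_leD[OF strict_mono_on_kummer_root[OF theta_pos], of j k] that by simp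
  have le_B: "later_prob 1 k (rate * (1 - T k \<omega>)) \<le> later_prob 0 k (rate * (1 - T k \<omega>))"
    if k: "1 \<le> k" and \<omega>: "\<omega> \<in> B k" for k \<omega>
  proof -
    obtain j where j: "1 \<le> j" "j \<le> k" "(1 - T j \<omega>) * rate \<le> kummer_root \<theta> j"
      using \<omega> by (auto simp: B_def U_def threshold_success_def)
    \<comment> \<open>Monotonicity of the roots enters here: from the good index j to k the
      remaining mean shrinks and the threshold grows, so \<open>k\<close> still satisfies the
      threshold inequality.\<close>
    have "T j \<omega> \<le> T k \<omega>"
      using epoch_mono[of \<omega> j k] j \<omega> by (auto simp: B_def)
    then have "(1 - T k \<omega>) * rate \<le> (1 - T j \<omega>) * rate"
      using rate_pos by (intro mult_right_mono) auto
    then have "rate * (1 - T k \<omega>) \<le> kummer_root \<theta> k"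
      using j root_mono[of j k] by (simp add: mult.commute)
    moreover have "0 < rate * (1 - T k \<omega>)"
      using \<omega> rate_pos by (auto simp: B_def)
    ultimately show ?thesis
      unfolding later_prob_0[OF k] later_prob_1[OF k]
      by (intro mult_left_mono kummer_root_below[OF theta_pos k]) auto
  qed
  have le_B': "later_prob 0 k (rate * (1 - T k \<omega>)) \<le> later_prob 1 k (rate * (1 - T k \<omega>))"
    if k: "1 \<le> k" and \<omega>: "\<omega> \<in> B' k" for k \<omega>
  proof -
    have "\<not> good \<omega> k"
      using \<omega> k by (auto simp: B'_def U_def)
    then have "kummer_root \<theta> k \<le> rate * (1 - T k \<omega>)"
      using \<omega> k by (auto simp: B'_def threshold_success_def mult.commute)
    then show ?thesis
      unfolding later_prob_0[OF k] later_prob_1[OF k]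
      by (intro mult_left_mono kummer_root_above[OF theta_pos k]) auto
  qed
  have WB: "prob (W 1 B) \<le> prob (W 0 B)"
    unfolding W_def
  proof (rule prob_union_over_epochs_mono[where B = B])
    show "prob {\<omega> \<in> B k. later_successes k \<omega> = 1} \<le> prob {\<omega> \<in> B k. later_successes k \<omega> = 0}"
      if "1 \<le> k" for k
      by (rule prob_later_successes_mono[OF that B_events(1)[OF that]])
        (use that hist(1) le_B in \<open>auto simp: B_def\<close>)
  qed (auto simp: B_events, auto simp: B_def)
  have WB': "prob (W 0 B') \<le> prob (W 1 B')"
    unfolding W_def
  proof (rule prob_union_over_epochs_mono[where B = B'])
    show "prob {\<omega> \<in> B' k. later_successes k \<omega> = 0} \<le> prob {\<omega> \<in> B' k. later_successes k \<omega> = 1}"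
      if "1 \<le> k" for k
      by (rule prob_later_successes_mono[OF that B_events(2)[OF that]])
        (use that hist(2) le_B' in \<open>auto simp: B'_def\<close>)
  qed (auto simp: B_events, auto simp: B'_def)
  have W_events: "W r D \<in> events" if "\<And>k. 1 \<le> k \<Longrightarrow> D k \<in> events" for r D
  proof -
    have "{\<omega> \<in> D k. later_successes k \<omega> = r} = D k \<inter> {\<omega> \<in> space M. later_successes k \<omega> = r}"
      if "1 \<le> k" for k
      using sets.sets_into_space[OF \<open>\<And>k. 1 \<le> k \<Longrightarrow> D k \<in> events\<close>[OF that]] by auto
    then have "W r D = (\<Union>k\<in>{1..}. D k \<inter> {\<omega> \<in> space M. later_successes k \<omega> = r})"
      unfolding W_def by simp
    then show ?thesis
      using that later_successes_measurable by (auto intro!: sets.countable_UN')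
  qed
  define V where "V \<rho> k = {\<omega> \<in> space M. T k \<omega> < 1 \<and> \<rho> \<omega> = T k \<omega> \<and> X k \<omega>}" for \<rho> k
  have win: "win_event M T X \<rho> = W 0 (V \<rho>)" for \<rho>
    unfolding win_event_eq W_def V_def by auto
  have V_events: "V \<rho> k \<in> events" if "\<rho> \<in> borel_measurable M" "1 \<le> k" for \<rho> k
  proof -
    have "V \<rho> k = {\<omega> \<in> space M. T k \<omega> < 1} \<inter> {\<omega> \<in> space M. \<rho> \<omega> = T k \<omega>} \<inter> {\<omega> \<in> space M. X k \<omega>}"
      by (auto simp: V_def)
    moreover have "{\<omega> \<in> space M. \<rho> \<omega> = T k \<omega>} \<in> events"
      using that epoch_measurable[OF that(2)] by simp
    ultimately show ?thesis
      using T_events[OF that(2)] mark_event[OF that(2)] by auto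
  qed
  note ev = W_events[OF V_events[OF \<sigma>_meas]] W_events[OF V_events[OF rule_meas]]
    W_events[OF B_events(1)] W_events[OF B_events(2)]
  have "AE \<omega> in M. indicator (W 0 (V \<sigma>)) \<omega> + indicator (W 0 B) \<omega> + indicator (W 1 B') \<omega> \<le>
      indicator (W 0 (V rule_time)) \<omega> + indicator (W 1 B) \<omega> + (indicator (W 0 B') \<omega> :: real)"
    using AE_epoch_neq_1
  proof (rule AE_mp, intro AE_I2 impI)
    fix \<omega> assume \<omega>: "\<omega> \<in> space M" and neq: "\<forall>k\<ge>1. T k \<omega> \<noteq> 1"
    have "indicator (W r D) \<omega> = (of_bool (\<exists>k\<ge>1. T k \<omega> < 1 \<and> X k \<omega> \<and> later_successes k \<omega> = r \<and> P k) :: real)"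
      if "\<And>k. \<omega> \<in> D k \<longleftrightarrow> T k \<omega> < 1 \<and> X k \<omega> \<and> P k" for r D P
      using that by (auto simp: W_def indicator_def)
    note ind = this[of "V \<sigma>" "\<lambda>k. \<sigma> \<omega> = T k \<omega>"] this[of "V rule_time" "\<lambda>k. rule_time \<omega> = T k \<omega>"]
      this[of B "\<lambda>k. U k \<omega> \<and> T k \<omega> < \<sigma> \<omega>"] this[of B' "\<lambda>k. \<not> U k \<omega> \<and> \<sigma> \<omega> \<le> T k \<omega>"]
    show "indicator (W 0 (V \<sigma>)) \<omega> + indicator (W 0 B) \<omega> + indicator (W 1 B') \<omega> \<le>
      indicator (W 0 (V rule_time)) \<omega> + indicator (W 1 B) \<omega> + (indicator (W 0 B') \<omega> :: real)"
      using win_indicator_bound[OF \<omega>, of "\<sigma> \<omega>"] neq \<omega>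
      by (subst ind, force simp: V_def B_def B'_def)+ (simp add: U_def)
  qed
  then have "(\<integral>\<omega>. indicator (W 0 (V \<sigma>)) \<omega> + indicator (W 0 B) \<omega> + indicator (W 1 B') \<omega> \<partial>M) \<le>
      (\<integral>\<omega>. indicator (W 0 (V rule_time)) \<omega> + indicator (W 1 B) \<omega> + (indicator (W 0 B') \<omega> :: real) \<partial>M)"
    by (intro integral_mono_AE Bochner_Integration.integrable_add integrable_real_indicator ev)
      (auto simp: less_top[symmetric])
  also have "\<dots> = prob (W 0 (V rule_time)) + prob (W 1 B) + prob (W 0 B')"
    using ev by (simp add: less_top[symmetric])
  also have "(\<integral>\<omega>. indicator (W 0 (V \<sigma>)) \<omega> + indicator (W 0 B) \<omega> + (indicator (W 1 B') \<omega> :: real) \<partial>M) =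
      prob (W 0 (V \<sigma>)) + prob (W 0 B) + prob (W 1 B')"
    using ev by (simp add: less_top[symmetric])
  finally show "prob (win_event M T X \<sigma>) \<le> prob (win_event M T X rule_time)"
    using WB WB' unfolding win by linarith
qed

end

theorem theorem2:
  fixes \<theta> :: real
  assumes "0 < \<theta>"
  shows "(\<forall>k\<ge>1. \<exists>!x. is_kummer_root \<theta> k x) \<and>
         strict_mono_on {1..} (kummer_root \<theta>) \<and>
         (\<forall>(rate::real) (M :: 'a measure) T X.
            0 < rate \<longrightarrow> last_success_problem M rate T \<theta> X \<longrightarrow>
            optimal_strategy M T X (threshold_rule rate (kummer_root \<theta>) T X))"
  using kummer_root_unique[OF assms] strict_mono_on_kummer_root[OF assms]
    last_success_problem.optimal_strategy_rule_time by blast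

end
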